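(* Let $m,n\ge 0$ be integers with $n\mid m/\gcd(2,m)$, and let $(A,B;D)$ be an amalgam of groups in the variety $(m,n)$. The amalgam is weakly embeddable in $(m,n)$ if and only if it is weakly embeddable in $\mathcal N_2$ and in addition $A^nA'\cap D\subseteq Z(B)$ and $B^nB'\cap D\subseteq Z(A)$.
   Context: Commutators are $[x,y]=x^{-1}y^{-1}xy$ and $[x,y,z]=[[x,y],z]$; $G'=[G,G]$; $Z(G)$ is the center. For $k>0$, $G^k$ is the subgroup generated by all $k$-th powers of elements of $G$, and $G^0=\{e\}$. Every integer divides $0$, and $0$ divides only $0$. For nonnegative integers $m,n$ with $n\mid m/\gcd(2,m)$, $(m,n)$ denotes the variety (class) of all groups satisfying the identities $x^m=[x_1,x_2]^n=[x_1,x_2,x_3]=e$. In particular $(0,0)=\mathcal N_2$ is the variety of all nilpotent groups of class at most two. An amalgam $(A,B;D)$ of groups in a class $\mathcal C$ consists of groups $A,B,D\in\mathcal C$ together with injective homomorphisms $D\to A$ and $D\to B$; $D$ is identified with its images, so it is regarded as a subgroup of both $A$ and $B$. It is weakly embeddable in $\mathcal C$ if there are $M\in\mathcal C$ and injective homomorphisms $\lambda_A\colon A\to M$, $\lambda_B\colon B\to M$ which agree on $D$. *)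

theory Defs
  imports "HOL-Algebra.Generated_Groups"
begin

definition commutator :: "('a, 'x) monoid_scheme \<Rightarrow> 'a \<Rightarrow> 'a \<Rightarrow> 'a" where
  "commutator G x y = inv\<^bsub>G\<^esub> x \<otimes>\<^bsub>G\<^esub> inv\<^bsub>G\<^esub> y \<otimes>\<^bsub>G\<^esub> x \<otimes>\<^bsub>G\<^esub> y"

definition center :: "('a, 'x) monoid_scheme \<Rightarrow> 'a set" where
  "center G = {z \<in> carrier G. \<forall>x \<in> carrier G. z \<otimes>\<^bsub>G\<^esub> x = x \<otimes>\<^bsub>G\<^esub> z}"

definition power_subgroup :: "('a, 'x) monoid_scheme \<Rightarrow> nat \<Rightarrow> 'a set" where
  "power_subgroup G k =
     (if k = 0 then {\<one>\<^bsub>G\<^esub>} else generate G {x [^]\<^bsub>G\<^esub> k | x. x \<in> carrier G})"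

definition in_variety :: "nat \<Rightarrow> nat \<Rightarrow> ('a, 'x) monoid_scheme \<Rightarrow> bool" where
  "in_variety m n G \<longleftrightarrow> group G
     \<and> (\<forall>x \<in> carrier G. x [^]\<^bsub>G\<^esub> m = \<one>\<^bsub>G\<^esub>)
     \<and> (\<forall>x \<in> carrier G. \<forall>y \<in> carrier G. commutator G x y [^]\<^bsub>G\<^esub> n = \<one>\<^bsub>G\<^esub>)
     \<and> (\<forall>x \<in> carrier G. \<forall>y \<in> carrier G. \<forall>z \<in> carrier G.
          commutator G (commutator G x y) z = \<one>\<^bsub>G\<^esub>)"

definition in_N2 :: "('a, 'x) monoid_scheme \<Rightarrow> bool" where
  "in_N2 G \<longleftrightarrow> in_variety 0 0 G"

text \<open>The embeddings \<open>\<alpha>\<close>, \<open>\<beta>\<close> of the core \<open>D\<close> are kept explicit.\<close>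

definition amalgam_in_variety ::
  "nat \<Rightarrow> nat \<Rightarrow> ('a, 'x) monoid_scheme \<Rightarrow> ('b, 'y) monoid_scheme \<Rightarrow> ('d, 'z) monoid_scheme
    \<Rightarrow> ('d \<Rightarrow> 'a) \<Rightarrow> ('d \<Rightarrow> 'b) \<Rightarrow> bool" where
  "amalgam_in_variety m n A B D \<alpha> \<beta> \<longleftrightarrow>
     in_variety m n A \<and> in_variety m n B \<and> in_variety m n D \<and> \<alpha> \<in> mon D A \<and> \<beta> \<in> mon D B"

text \<open>
  HOL cannot quantify over the carrier type of the ambient group \<open>M\<close>, so the type \<open>('a + 'b) list\<close>
  is used. This loses no generality for the classes considered here: the subgroup of \<open>M\<close>
  generated by the images of \<open>A\<close> and \<open>B\<close> lies in the class too, and its elements are values of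
  words over the disjoint union of \<open>A\<close> and \<open>B\<close>. See \<open>weakly_embeddable_variety_iff\<close> below.
\<close>

definition weakly_embeddable ::
  "(('a + 'b) list monoid \<Rightarrow> bool) \<Rightarrow> ('a, 'x) monoid_scheme \<Rightarrow> ('b, 'y) monoid_scheme
    \<Rightarrow> ('d, 'z) monoid_scheme \<Rightarrow> ('d \<Rightarrow> 'a) \<Rightarrow> ('d \<Rightarrow> 'b) \<Rightarrow> bool" where
  "weakly_embeddable C A B D \<alpha> \<beta> \<longleftrightarrow>
     (\<exists>M f g. C M \<and> f \<in> mon A M \<and> g \<in> mon B M \<and> (\<forall>d \<in> carrier D. f (\<alpha> d) = g (\<beta> d)))"

text \<open>
  The library's \<open>derived\<close> is generated by the elements \<open>x y x\<inverse> y\<inverse>\<close>; on the whole group this is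
  the subgroup generated by the commutators above.
\<close>

lemma derived_set_eq_commutators:
  assumes "group G"
  shows "derived_set G (carrier G) = {commutator G x y | x y. x \<in> carrier G \<and> y \<in> carrier G}"
proof -
  interpret group G by fact
  let ?K = "{commutator G x y | x y. x \<in> carrier G \<and> y \<in> carrier G}"
  have 1: "x \<otimes>\<^bsub>G\<^esub> y \<otimes>\<^bsub>G\<^esub> inv\<^bsub>G\<^esub> x \<otimes>\<^bsub>G\<^esub> inv\<^bsub>G\<^esub> y \<in> ?K" if "x \<in> carrier G" "y \<in> carrier G" for x y
    using that
    by (intro CollectI exI[of _ "inv\<^bsub>G\<^esub> x"] exI[of _ "inv\<^bsub>G\<^esub> y"]) (simp add: commutator_def)
  have 2: "commutator G x y \<in> derived_set G (carrier G)"
    if "x \<in> carrier G" "y \<in> carrier G" for x y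
    using that
    by (intro UN_I[of "inv\<^bsub>G\<^esub> x"] UN_I[of "inv\<^bsub>G\<^esub> y"]) (simp_all add: commutator_def)
  show ?thesis
  proof (intro equalityI subsetI)
    fix c assume "c \<in> derived_set G (carrier G)"
    then obtain x y where "x \<in> carrier G" "y \<in> carrier G"
      and c: "c = x \<otimes>\<^bsub>G\<^esub> y \<otimes>\<^bsub>G\<^esub> inv\<^bsub>G\<^esub> x \<otimes>\<^bsub>G\<^esub> inv\<^bsub>G\<^esub> y"
      by (elim UN_E singletonE)
    then show "c \<in> ?K"
      unfolding c by (intro 1)
  next
    fix c assume "c \<in> ?K"
    then obtain x y where "x \<in> carrier G" "y \<in> carrier G" and c: "c = commutator G x y"
      by (elim CollectE exE conjE)
    then show "c \<in> derived_set G (carrier G)"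
      unfolding c by (intro 2)
  qed
qed

lemma in_N2_iff: "in_N2 G \<longleftrightarrow> group G \<and> derived G (carrier G) \<subseteq> center G"
proof (cases "group G")
  case True
  then interpret group G .
  have cc: "commutator G x y \<in> carrier G" if "x \<in> carrier G" "y \<in> carrier G" for x y
    using that by (simp add: commutator_def)
  have ce: "commutator G x y = \<one>\<^bsub>G\<^esub> \<longleftrightarrow> x \<otimes>\<^bsub>G\<^esub> y = y \<otimes>\<^bsub>G\<^esub> x"
    if "x \<in> carrier G" "y \<in> carrier G" for x y
  proof -
    have "commutator G x y = inv\<^bsub>G\<^esub> (y \<otimes>\<^bsub>G\<^esub> x) \<otimes>\<^bsub>G\<^esub> (x \<otimes>\<^bsub>G\<^esub> y)"
      using that by (simp add: commutator_def inv_mult_group m_assoc)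
    then show ?thesis
      using that by (metis inv_closed inv_equality inv_inv l_inv m_closed)
  qed
  have "subgroup (center G) G"
  proof (rule subgroupI)
    show "inv\<^bsub>G\<^esub> a \<in> center G" if "a \<in> center G" for a
      using that unfolding center_def
      by (auto) (metis inv_closed inv_inv inv_mult_group)
    show "a \<otimes>\<^bsub>G\<^esub> b \<in> center G" if "a \<in> center G" "b \<in> center G" for a b
    proof -
      have "a \<otimes>\<^bsub>G\<^esub> b \<otimes>\<^bsub>G\<^esub> x = x \<otimes>\<^bsub>G\<^esub> (a \<otimes>\<^bsub>G\<^esub> b)" if x: "x \<in> carrier G" for x
      proof -
        have ab: "a \<in> carrier G" "b \<in> carrier G"
          and comm: "a \<otimes>\<^bsub>G\<^esub> x = x \<otimes>\<^bsub>G\<^esub> a" "b \<otimes>\<^bsub>G\<^esub> x = x \<otimes>\<^bsub>G\<^esub> b"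
          using \<open>a \<in> center G\<close> \<open>b \<in> center G\<close> x by (auto simp: center_def)
        have "a \<otimes>\<^bsub>G\<^esub> b \<otimes>\<^bsub>G\<^esub> x = a \<otimes>\<^bsub>G\<^esub> x \<otimes>\<^bsub>G\<^esub> b"
          using ab x comm(2) by (simp add: m_assoc)
        then show ?thesis
          using ab x comm(1) by (simp add: m_assoc)
      qed
      moreover have "a \<otimes>\<^bsub>G\<^esub> b \<in> carrier G"
        using that unfolding center_def by blast
      ultimately show ?thesis
        unfolding center_def by blast
    qed
    have "\<one>\<^bsub>G\<^esub> \<in> center G" by (simp add: center_def)
    then show "center G \<noteq> {}" by blast
    show "center G \<subseteq> carrier G" unfolding center_def by blast
  qed
  then have "derived G (carrier G) \<subseteq> center G \<longleftrightarrow>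
      {commutator G x y | x y. x \<in> carrier G \<and> y \<in> carrier G} \<subseteq> center G" (is "_ \<longleftrightarrow> ?K \<subseteq> _")
    unfolding derived_def derived_set_eq_commutators[OF True]
    using generate_subgroup_incl[of ?K "center G"] generate.incl[of _ ?K G] by blast
  also have "\<dots> \<longleftrightarrow> (\<forall>x \<in> carrier G. \<forall>y \<in> carrier G. commutator G x y \<in> center G)"
    by blast
  also have "\<dots> \<longleftrightarrow> (\<forall>x \<in> carrier G. \<forall>y \<in> carrier G. \<forall>z \<in> carrier G.
      commutator G (commutator G x y) z = \<one>\<^bsub>G\<^esub>)"
    by (simp add: cc ce center_def)
  finally show ?thesis
    using True by (simp add: in_N2_def in_variety_def)
qed (simp add: in_N2_def in_variety_def)

lemma in_variety_mon:
  assumes N: "group N" and h: "h \<in> mon N M" and M: "in_variety m n M"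
  shows "in_variety m n N"
proof -
  interpret group_hom N M h
    using N h M by (simp add: group_hom_def group_hom_axioms_def mon_def in_variety_def)
  have inj: "x = \<one>\<^bsub>N\<^esub>" if "x \<in> carrier N" "h x = \<one>\<^bsub>M\<^esub>" for x
    using h that inj_onD[of h "carrier N" x "\<one>\<^bsub>N\<^esub>"] by (auto simp: mon_def)
  have cc: "commutator N x y \<in> carrier N" if "x \<in> carrier N" "y \<in> carrier N" for x y
    using that by (simp add: commutator_def)
  have hc: "h (commutator N x y) = commutator M (h x) (h y)"
    if "x \<in> carrier N" "y \<in> carrier N" for x y
    using that by (simp add: commutator_def)
  show ?thesis
    using M N unfolding in_variety_def by (auto intro!: inj simp: cc hc hom_nat_pow)
qed

lemma weakly_embeddableI:
  fixes A :: "('a, 'x) monoid_scheme" and B :: "('b, 'y) monoid_scheme"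
    and M :: "('c, 'w) monoid_scheme"
  assumes A: "group A" and B: "group B" and M: "in_variety m n M"
    and f: "f \<in> mon A M" and g: "g \<in> mon B M"
    and \<alpha>: "\<alpha> \<in> carrier D \<rightarrow> carrier A" and \<beta>: "\<beta> \<in> carrier D \<rightarrow> carrier B"
    and agree: "\<And>d. d \<in> carrier D \<Longrightarrow> f (\<alpha> d) = g (\<beta> d)"
  shows "weakly_embeddable (in_variety m n) A B D \<alpha> \<beta>"
proof -
  interpret M: group M using M by (simp add: in_variety_def)
  interpret f: group_hom A M f
    using A f by (simp add: group_hom_def group_hom_axioms_def mon_def M.is_group)
  interpret g: group_hom B M g
    using B g by (simp add: group_hom_def group_hom_axioms_def mon_def M.is_group)
  define ev where "ev = (\<lambda>xs. foldr (\<lambda>x r. case_sum f g x \<otimes>\<^bsub>M\<^esub> r) xs \<one>\<^bsub>M\<^esub>)"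
  define T where "T = carrier A <+> carrier B"
  define X where "X = f ` carrier A \<union> g ` carrier B"
  define S where "S = generate M X"
  have ev_closed: "ev xs \<in> carrier M" if "xs \<in> lists T" for xs
    using that by (induction xs) (auto simp: ev_def T_def)
  have ev_append: "ev (xs @ ys) = ev xs \<otimes>\<^bsub>M\<^esub> ev ys" if "xs \<in> lists T" "ys \<in> lists T" for xs ys
    using that(1)
  proof (induction xs)
    case Nil
    then show ?case using ev_closed[OF that(2)] by (simp add: ev_def)
  next
    case (Cons x xs)
    have "case_sum f g x \<in> carrier M" using Cons.hyps(1) by (auto simp: T_def)
    then show ?case
      using Cons ev_closed[OF that(2)] ev_closed[of xs] by (simp add: ev_def M.m_assoc)
  qed
  have ev_f: "\<exists>xs \<in> lists T. ev xs = f a" if "a \<in> carrier A" for a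
    using that by (intro bexI[of _ "[Inl a]"]) (auto simp: ev_def T_def)
  have ev_g: "\<exists>xs \<in> lists T. ev xs = g b" if "b \<in> carrier B" for b
    using that by (intro bexI[of _ "[Inr b]"]) (auto simp: ev_def T_def)
  have word: "\<exists>xs \<in> lists T. ev xs = s" if "s \<in> S" for s
    using that unfolding S_def
  proof (induction s rule: generate.induct)
    case one
    then show ?case by (intro bexI[of _ "[]"]) (auto simp: ev_def)
  next
    case (incl h)
    then show ?case using ev_f ev_g by (auto simp: X_def)
  next
    case (inv h)
    then show ?case
      unfolding X_def
      by (metis A B UnE ev_f ev_g f.hom_inv g.hom_inv group.inv_closed imageE)
  next
    case (eng h1 h2)
    then show ?case by (metis append_in_lists_conv ev_append)
  qed
  have subS: "subgroup S M"
    unfolding S_def by (rule M.generate_is_subgroup) (auto simp: X_def)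
  define i where "i = (\<lambda>s. SOME xs. ev xs = s)"
  have ev_i: "ev (i s) = s" if "s \<in> S" for s
    using word[OF that] unfolding i_def by (metis (mono_tags, lifting) someI_ex)
  define N where "N = \<lparr>carrier = i ` S, mult = (\<lambda>x y. i (ev x \<otimes>\<^bsub>M\<^esub> ev y)), one = i \<one>\<^bsub>M\<^esub>\<rparr>"
  interpret S: group "M\<lparr>carrier := S\<rparr>"
    using subS M.subgroup_imp_group by blast
  have iso: "i \<in> iso (M\<lparr>carrier := S\<rparr>) N"
    by (rule isoI) (auto simp: hom_def bij_betw_def N_def ev_i intro!: inj_on_inverseI[of _ ev])
  have grpN: "group N"
    using S.iso_imp_img_group[OF iso] by (simp add: N_def)
  have "ev \<in> mon N M"
    using subgroup.mem_carrier[OF subS] subgroup.m_closed[OF subS]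
    by (auto simp: mon_def hom_def N_def ev_i inj_on_def)
  then have varN: "in_variety m n N"
    using in_variety_mon grpN M by blast
  have monS: "i \<in> mon (M\<lparr>carrier := S\<rparr>) N"
    using iso by (simp add: iso_iff_mon_epi)
  have XS: "x \<in> S" if "x \<in> X" for x
    using that unfolding S_def by (rule generate.incl)
  have fS: "f \<in> mon A (M\<lparr>carrier := S\<rparr>)"
    using f XS by (auto simp: mon_def hom_def X_def)
  have gS: "g \<in> mon B (M\<lparr>carrier := S\<rparr>)"
    using g XS by (auto simp: mon_def hom_def X_def)
  have "i \<circ> f \<in> mon A N" "i \<circ> g \<in> mon B N"
    using mon_compose[OF fS monS] mon_compose[OF gS monS] by auto
  then show ?thesis
    unfolding weakly_embeddable_def using varN agree
    by (intro exI[of _ N] exI[of _ "i \<circ> f"] exI[of _ "i \<circ> g"]) auto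
qed

lemma weakly_embeddable_variety_iff:
  fixes A :: "('a, 'x) monoid_scheme" and B :: "('b, 'y) monoid_scheme"
    and D :: "('d, 'z) monoid_scheme"
  assumes "group A" "group B" "\<alpha> \<in> carrier D \<rightarrow> carrier A" "\<beta> \<in> carrier D \<rightarrow> carrier B"
    and universe: "\<exists>j :: ('a + 'b) list \<Rightarrow> 'c. inj j"
  shows "weakly_embeddable (in_variety m n) A B D \<alpha> \<beta> \<longleftrightarrow>
    (\<exists>(M :: 'c monoid) f g. in_variety m n M \<and> f \<in> mon A M \<and> g \<in> mon B M
        \<and> (\<forall>d \<in> carrier D. f (\<alpha> d) = g (\<beta> d)))"
    (is "?L \<longleftrightarrow> ?R")
proof
  assume ?R
  then obtain M :: "'c monoid" and f g where "in_variety m n M" "f \<in> mon A M" "g \<in> mon B M"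
    and "\<forall>d \<in> carrier D. f (\<alpha> d) = g (\<beta> d)"
    by blast
  then show ?L
    using assms(1-4) by (intro weakly_embeddableI[of A B m n M f g]) auto
next
  assume ?L
  then obtain M :: "('a + 'b) list monoid" and f g where M: "in_variety m n M"
    and fg: "f \<in> mon A M" "g \<in> mon B M" "\<forall>d \<in> carrier D. f (\<alpha> d) = g (\<beta> d)"
    unfolding weakly_embeddable_def by blast
  obtain j :: "('a + 'b) list \<Rightarrow> 'c" where j: "inj j" using universe by blast
  interpret M: group M using M by (simp add: in_variety_def)
  define N where "N = \<lparr>carrier = j ` carrier M,
    mult = (\<lambda>x y. j (inv_into UNIV j x \<otimes>\<^bsub>M\<^esub> inv_into UNIV j y)), one = j \<one>\<^bsub>M\<^esub>\<rparr>"
  have iso: "j \<in> iso M N"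
    using j by (intro isoI) (auto simp: hom_def bij_betw_def N_def intro: inj_on_subset)
  have grpN: "group N"
    using M.iso_imp_img_group[OF iso] by (simp add: N_def)
  have "inv_into UNIV j \<in> mon N M"
    using j by (auto simp: mon_def hom_def N_def inj_on_def)
  then have "in_variety m n N" using in_variety_mon grpN M by blast
  moreover have "j \<circ> f \<in> mon A N" "j \<circ> g \<in> mon B N"
    using iso fg by (auto simp: iso_iff_mon_epi intro: mon_compose)
  ultimately show ?R
    using fg by (intro exI[of _ N] exI[of _ "j \<circ> f"] exI[of _ "j \<circ> g"]) auto
qed

end

theory Submission
  imports Defs "HOL-Algebra.Free_Abelian_Groups"
begin

text \<open>
  If \<open>A, B \<le> M\<close> with \<open>M\<close> in \<open>(m,n)\<close>, then \<open>[x^n, y] = [x,y]^n = 1\<close>, so the images of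
  \<open>A^n A'\<close> and \<open>B^n B'\<close> are central in \<open>M\<close>; this gives necessity.

  For sufficiency let \<open>n > 0\<close> (\<open>n = 0\<close> forces \<open>m = 0\<close>) and let \<open>M\<close> be of class two with
  \<open>A, B \<le> M\<close>. The \<open>n\<close>-th powers of the commutators \<open>[a,b]\<close> define a pairing
  \<open>A/DA' \<times> B/DB' \<rightarrow> Z(M)\<close>. The centrality conditions imply that it kills the \<open>n\<close>-torsion of
  \<open>A/DA' \<otimes> B/DB'\<close>. Hence it becomes divisible by \<open>n\<close> in an abelian group \<open>E \<supseteq> Z(M)\<close>: there is a
  pairing \<open>\<mu>\<close> with values in \<open>E\<close>, trivial on \<open>D\<close>, such that \<open>\<mu>(a,b)^n = [a,b]^n\<close>.
  Replacing the commutators \<open>[b,a]\<close> of \<open>M\<close> by \<open>[b,a] \<mu>(a,b)\<close> yields commutators of exponent \<open>n\<close>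
  and changes nothing where \<open>D\<close> is involved, so that the resulting group on \<open>A \<times> B \<times> E[n]\<close>, with the
  two copies of \<open>D\<close> identified, contains the amalgam and lies in \<open>(m,n)\<close>.
\<close>

lemma frag_cmul_diff_distrib2: "frag_cmul c (a - b) = frag_cmul c a - frag_cmul c b"
  by (metis add_diff_cancel diff_add_cancel frag_cmul_distrib2)

section \<open>Elementary divisors and torsion in tensor products\<close>

text \<open>
  \<open>KU\<close>, \<open>KV\<close> and \<open>L\<close> are the relations of abelian groups presented by generators; think of \<open>t\<close> as
  the tensor product. A tensor \<open>\<Sum> u j \<otimes> v j\<close> is killed by \<open>n\<close> iff the elements \<open>n (u j)\<close> are integral
  combinations of some \<open>w i\<close> whose coefficient matrix annihilates \<open>v\<close> (the predicate \<open>system\<close> below).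
  Assumption \<open>divisor\<close> is the case of a \<open>1 \<times> 1\<close> matrix, and the general case reduces to it by bringing
  the matrix into diagonal form.
\<close>

locale torsion_pairing =
  fixes t :: "('a \<Rightarrow>\<^sub>0 int) \<Rightarrow> ('b \<Rightarrow>\<^sub>0 int) \<Rightarrow> ('c \<Rightarrow>\<^sub>0 int)"
    and KU :: "('a \<Rightarrow>\<^sub>0 int) set" and KV :: "('b \<Rightarrow>\<^sub>0 int) set" and L :: "('c \<Rightarrow>\<^sub>0 int) set"
    and n :: int
  assumes t_add_left: "t (u + u') v = t u v + t u' v"
    and t_add_right: "t u (v + v') = t u v + t u v'"
    and t_cmul_left: "t (frag_cmul c u) v = frag_cmul c (t u v)"
    and t_cmul_right: "t u (frag_cmul c v) = frag_cmul c (t u v)"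
    and KU_diff: "x \<in> KU \<Longrightarrow> x' \<in> KU \<Longrightarrow> x - x' \<in> KU"
    and KU_cmul: "x \<in> KU \<Longrightarrow> frag_cmul c x \<in> KU"
    and KV_diff: "y \<in> KV \<Longrightarrow> y' \<in> KV \<Longrightarrow> y - y' \<in> KV"
    and KV_cmul: "y \<in> KV \<Longrightarrow> frag_cmul c y \<in> KV"
    and zero_mem_KV: "0 \<in> KV" and zero_mem_L: "0 \<in> L"
    and L_add: "z \<in> L \<Longrightarrow> z' \<in> L \<Longrightarrow> z + z' \<in> L"
    and divisor: "frag_cmul n u - frag_cmul k w \<in> KU \<Longrightarrow> frag_cmul k v \<in> KV \<Longrightarrow> t u v \<in> L"
begin

definition system ::
  "'i set \<Rightarrow> 'j set \<Rightarrow> ('i \<Rightarrow> 'j \<Rightarrow> int) \<Rightarrow> ('j \<Rightarrow> 'a \<Rightarrow>\<^sub>0 int) \<Rightarrow> ('i \<Rightarrow> 'a \<Rightarrow>\<^sub>0 int) \<Rightarrow> ('j \<Rightarrow> 'b \<Rightarrow>\<^sub>0 int) \<Rightarrow> bool"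
  where "system I J c u w v \<longleftrightarrow>
    (\<forall>j \<in> J. frag_cmul n (u j) - (\<Sum>i\<in>I. frag_cmul (c i j) (w i)) \<in> KU) \<and>
    (\<forall>i \<in> I. (\<Sum>j\<in>J. frag_cmul (c i j) (v j)) \<in> KV)"

section \<open>Row and column operations on systems of relations\<close>

text \<open>Coefficients and vectors are transformed by mutually inverse unipotent matrices, which
  cancel in the combination; \<open>q i0 = 0\<close> makes the sign change of \<open>q\<close> the
  inverse. It serves both for rows, acting on \<open>w\<close>, and for columns, acting on
  \<open>v\<close>.\<close>

lemma sum_elementary_operation:
  fixes w :: "'i \<Rightarrow> ('d \<Rightarrow>\<^sub>0 int)"
  assumes "finite I" "i0 \<in> I" "q i0 = 0"
  shows "(\<Sum>i\<in>I. frag_cmul (c i - q i * c i0) ((w(i0 := w i0 + (\<Sum>i\<in>I. frag_cmul (q i) (w i)))) i))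
       = (\<Sum>i\<in>I. frag_cmul (c i) (w i))"
proof -
  have q: "(\<Sum>i\<in>I. frag_cmul (q i) (w i)) = (\<Sum>i\<in>I - {i0}. frag_cmul (q i) (w i))"
    using assms by (subst sum.remove[of I i0]) auto
  have "(\<Sum>i\<in>I. frag_cmul (c i - q i * c i0) ((w(i0 := w i0 + (\<Sum>i\<in>I. frag_cmul (q i) (w i)))) i))
     = frag_cmul (c i0) (w i0 + (\<Sum>i\<in>I. frag_cmul (q i) (w i)))
       + (\<Sum>i\<in>I - {i0}. frag_cmul (c i - q i * c i0) (w i))"
    using assms by (subst sum.remove[of I i0]) auto
  also have "(\<Sum>i\<in>I - {i0}. frag_cmul (c i - q i * c i0) (w i))
     = (\<Sum>i\<in>I - {i0}. frag_cmul (c i) (w i)) - frag_cmul (c i0) (\<Sum>i\<in>I. frag_cmul (q i) (w i))"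
    unfolding q frag_cmul_sum sum_subtractf[symmetric]
    by (intro sum.cong) (auto simp: frag_cmul_diff_distrib mult.commute)
  finally show ?thesis
    using assms by (simp add: sum.remove[of I i0] frag_cmul_distrib2)
qed

text \<open>The change of \<open>w\<close> compensates that of the coefficients, so the relations in
  \<open>KU\<close> do not change, while each new row of \<open>v\<close>-relations is an integral
  combination of old ones.\<close>

lemma system_row_operation:
  assumes "system I J c u w v" "finite I" "i0 \<in> I" "q i0 = 0"
  shows "system I J (\<lambda>i j. c i j - q i * c i0 j) u
      (w(i0 := w i0 + (\<Sum>i\<in>I. frag_cmul (q i) (w i)))) v"
proof -
  have "(\<Sum>j\<in>J. frag_cmul (c i j - q i * c i0 j) (v j))
      = (\<Sum>j\<in>J. frag_cmul (c i j) (v j)) - frag_cmul (q i) (\<Sum>j\<in>J. frag_cmul (c i0 j) (v j))" for i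
    unfolding frag_cmul_sum sum_subtractf[symmetric]
    by (intro sum.cong) (auto simp: frag_cmul_diff_distrib)
  moreover have "(\<Sum>i\<in>I. frag_cmul (c i j - q i * c i0 j)
        ((w(i0 := w i0 + (\<Sum>i\<in>I. frag_cmul (q i) (w i)))) i)) = (\<Sum>i\<in>I. frag_cmul (c i j) (w i))" for j
    using sum_elementary_operation[of I i0 q "\<lambda>i. c i j" w] assms(2-4) by blast
  ultimately show ?thesis
    using assms(1,3) unfolding system_def by (simp only:) (blast intro: KV_diff KV_cmul)
qed

text \<open>Dual to the row operation: the columns and the \<open>u j\<close> undergo the same
  change, so the new relations are combinations of old ones in \<open>KU\<close>, while
  \<open>v\<close> compensates in the relations of \<open>KV\<close>.\<close>

lemma system_column_operation:
  assumes "system I J c u w v" "finite J" "j0 \<in> J" "q j0 = 0"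
  shows "system I J (\<lambda>i j. c i j - q j * c i j0) (\<lambda>j. u j - frag_cmul (q j) (u j0)) w
      (v(j0 := v j0 + (\<Sum>j\<in>J. frag_cmul (q j) (v j))))"
proof -
  have "frag_cmul n (u j - frag_cmul (q j) (u j0)) - (\<Sum>i\<in>I. frag_cmul (c i j - q j * c i j0) (w i))
      = (frag_cmul n (u j) - (\<Sum>i\<in>I. frag_cmul (c i j) (w i)))
        - frag_cmul (q j) (frag_cmul n (u j0) - (\<Sum>i\<in>I. frag_cmul (c i j0) (w i)))" for j
  proof -
    have "(\<Sum>i\<in>I. frag_cmul (c i j - q j * c i j0) (w i))
      = (\<Sum>i\<in>I. frag_cmul (c i j) (w i)) - frag_cmul (q j) (\<Sum>i\<in>I. frag_cmul (c i j0) (w i))"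
      unfolding frag_cmul_sum sum_subtractf[symmetric]
      by (intro sum.cong) (auto simp: frag_cmul_diff_distrib)
    then show ?thesis
      by (simp add: frag_cmul_diff_distrib2 mult.commute)
  qed
  then show ?thesis
    using assms(1,3) unfolding system_def
    by (simp only: sum_elementary_operation[OF assms(2-3), of q, OF assms(4)]) (blast intro: KU_diff KU_cmul)
qed

text \<open>The families \<open>u\<close> and \<open>v\<close> are changed contragrediently, so by
  bilinearity the tensor itself is unaffected by a column operation.\<close>

lemma sum_pairing_column_operation:
  assumes "finite J" "j0 \<in> J" "q j0 = 0"
  shows "(\<Sum>j\<in>J. t (u j - frag_cmul (q j) (u j0))
            ((v(j0 := v j0 + (\<Sum>j\<in>J. frag_cmul (q j) (v j)))) j)) = (\<Sum>j\<in>J. t (u j) (v j))"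
proof -
  have t_diff: "t (x - frag_cmul c y) z = t x z - frag_cmul c (t y z)" for x y z c
    by (metis add_diff_cancel diff_add_cancel t_add_left t_cmul_left)
  have t_sum: "t x (\<Sum>j\<in>S. frag_cmul (q j) (v j)) = (\<Sum>j\<in>S. frag_cmul (q j) (t x (v j)))"
    if "finite S" for x S
    using that
  proof induction
    case empty
    then show ?case using t_cmul_right[of x 0 0] by simp
  qed (simp add: t_add_right t_cmul_right)
  have q: "(\<Sum>j\<in>J. frag_cmul (q j) (v j)) = (\<Sum>j\<in>J - {j0}. frag_cmul (q j) (v j))"
    using assms by (subst sum.remove[of J j0]) auto
  show ?thesis
    unfolding q using assms
    by (simp add: sum.remove[of J j0] t_diff t_add_right t_sum sum_subtractf)
qed

text \<open>Integral elimination: a pivot alone in its row and column splits off one summand, which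
  \<open>divisor\<close> handles, and leaves a system with one column fewer. The outer induction
  removes columns, the inner one decreases the absolute value of the pivot.\<close>

lemma sum_pairing_system:
  assumes "finite I" "finite J" "system I J c u w v"
  shows "(\<Sum>j\<in>J. t (u j) (v j)) \<in> L"
  using assms(2,3)
proof (induction "card J" arbitrary: J c u w v rule: less_induct)
  case less
  note IH = less.hyps
  have pivot: "(\<Sum>j\<in>J. t (u j) (v j)) \<in> L"
    if "system I J c u w v" "i0 \<in> I" "j0 \<in> J" "c i0 j0 \<noteq> 0" for c u w v i0 j0
    using that
  proof (induction "nat \<bar>c i0 j0\<bar>" arbitrary: c u w v i0 j0 rule: less_induct)
    case (less c i0 j0 u w v)
    have smaller: "nat \<bar>x mod c i0 j0\<bar> < nat \<bar>c i0 j0\<bar>" for x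
      using less.prems(4) abs_mod_less[of "c i0 j0" x] by linarith
    \<comment> \<open>Division by the pivot: after the row operation the other entries of the pivot
      column are remainders. The value 0 at \<open>i0\<close> keeps the pivot row fixed.\<close>
    define q where "q i = (if i = i0 then 0 else c i j0 div c i0 j0)" for i
    define c1 where "c1 i j = c i j - q i * c i0 j" for i j
    define w1 where "w1 = w(i0 := w i0 + (\<Sum>i\<in>I. frag_cmul (q i) (w i)))"
    have sys1: "system I J c1 u w1 v"
      using system_row_operation[OF less.prems(1) \<open>finite I\<close> less.prems(2), of q]
      unfolding c1_def w1_def q_def by simp
    have c1_col: "c1 i j0 = c i j0 mod c i0 j0" if "i \<noteq> i0" for i
      using that by (simp add: c1_def q_def minus_div_mult_eq_mod)
    have c1_row: "c1 i0 j = c i0 j" for j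
      by (simp add: c1_def q_def)
    \<comment> \<open>The same for the pivot row by a column operation. It leaves the pivot column
      alone, so a cleared column stays cleared.\<close>
    define p where "p j = (if j = j0 then 0 else c1 i0 j div c1 i0 j0)" for j
    define c2 where "c2 i j = c1 i j - p j * c1 i j0" for i j
    define u2 where "u2 j = u j - frag_cmul (p j) (u j0)" for j
    define v2 where "v2 = v(j0 := v j0 + (\<Sum>j\<in>J. frag_cmul (p j) (v j)))"
    have sys2: "system I J c2 u2 w1 v2"
      using system_column_operation[OF sys1 \<open>finite J\<close> less.prems(3), of p]
      unfolding c2_def u2_def v2_def p_def by simp
    have sum2: "(\<Sum>j\<in>J. t (u2 j) (v2 j)) = (\<Sum>j\<in>J. t (u j) (v j))"
      using sum_pairing_column_operation[OF \<open>finite J\<close> less.prems(3), of p u v]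
      unfolding u2_def v2_def p_def by simp
    have c2_row: "c2 i0 j = c i0 j mod c i0 j0" if "j \<noteq> j0" for j
      using that by (simp add: c2_def p_def c1_row minus_div_mult_eq_mod)
    have c2_col: "c2 i j0 = c1 i j0" for i
      by (simp add: c2_def p_def)
    \<comment> \<open>Any nonzero remainder has smaller absolute value than the pivot and serves as
      the next pivot. If there is none, the pivot stands alone in its row and column.\<close>
    show ?case
    proof (cases "\<exists>i\<in>I. i \<noteq> i0 \<and> c1 i j0 \<noteq> 0")
      case True
      then obtain i where i: "i \<in> I" "i \<noteq> i0" "c1 i j0 \<noteq> 0" by blast
      then show ?thesis
        using less.hyps[of c1 i j0 u w1 v] smaller less.prems(3) sys1 c1_col by simp
    next
      case no_col: False
      show ?thesis
      proof (cases "\<exists>j\<in>J. j \<noteq> j0 \<and> c2 i0 j \<noteq> 0")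
        case True
        then obtain j where j: "j \<in> J" "j \<noteq> j0" "c2 i0 j \<noteq> 0" by blast
        then show ?thesis
          using less.hyps[of c2 i0 j u2 w1 v2] smaller less.prems(2) sys2 c2_row sum2 by simp
      next
        case no_row: False
        have col: "c2 i j0 = 0" if "i \<in> I" "i \<noteq> i0" for i
          using no_col that c2_col by auto
        have row: "c2 i0 j = 0" if "j \<in> J" "j \<noteq> j0" for j
          using no_row that by auto
        have "(\<Sum>i\<in>I. frag_cmul (c2 i j0) (w1 i)) = frag_cmul (c2 i0 j0) (w1 i0)"
          using \<open>finite I\<close> less.prems(2) col by (subst sum.remove[of I i0]) auto
        moreover have "(\<Sum>j\<in>J. frag_cmul (c2 i0 j) (v2 j)) = frag_cmul (c2 i0 j0) (v2 j0)"
          using \<open>finite J\<close> less.prems(3) row by (subst sum.remove[of J j0]) auto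
        ultimately have "t (u2 j0) (v2 j0) \<in> L"
          using sys2 less.prems(2,3) unfolding system_def by (metis divisor)
        moreover have "(\<Sum>j\<in>J - {j0}. t (u2 j) (v2 j)) \<in> L"
        proof (rule IH)
          show "card (J - {j0}) < card J"
            using \<open>finite J\<close> less.prems(3) by (rule card_Diff1_less)
          \<comment> \<open>Only the column \<open>j0\<close> is dropped. The row \<open>i0\<close>
            stays in \<open>I\<close> with zero coefficients, so its condition becomes the
            membership of 0 in \<open>KV\<close>.\<close>
          have "(\<Sum>j\<in>J - {j0}. frag_cmul (c2 i j) (v2 j)) \<in> KV" if "i \<in> I" for i
          proof (cases "i = i0")
            case True
            then show ?thesis
              using zero_mem_KV row by simp
          next
            case False
            then show ?thesis
              using that sys2 col \<open>finite J\<close> less.prems(3) sum.remove[of J j0 "\<lambda>j. frag_cmul (c2 i j) (v2 j)"]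
              unfolding system_def by auto
          qed
          then show "system I (J - {j0}) c2 u2 w1 v2"
            using sys2 unfolding system_def by blast
        qed (use \<open>finite J\<close> in simp)
        ultimately have "(\<Sum>j\<in>J. t (u2 j) (v2 j)) \<in> L"
          using \<open>finite J\<close> less.prems(3) by (simp add: sum.remove[of J j0] L_add)
        then show ?thesis using sum2 by simp
      qed
    qed
  qed
  show ?case
  proof (cases "\<exists>i\<in>I. \<exists>j\<in>J. c i j \<noteq> 0")
    case True
    then show ?thesis
      using pivot less.prems by blast
  next
    case False
    \<comment> \<open>For the zero matrix each multiple of \<open>u j\<close> by \<open>n\<close>
      lies in \<open>KU\<close>, which is the case \<open>k = 0\<close> of
      \<open>divisor\<close>.\<close>
    have "t (u j) (v j) \<in> L" if "j \<in> J" for j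
    proof (rule divisor[where k = 0 and w = 0])
      have "(\<Sum>i\<in>I. frag_cmul (c i j) (w i)) = 0"
        using that False by (intro sum.neutral) auto
      then show "frag_cmul n (u j) - frag_cmul 0 0 \<in> KU"
        using less.prems that unfolding system_def by force
      show "frag_cmul 0 (v j) \<in> KV"
        using zero_mem_KV by simp
    qed
    with \<open>finite J\<close> show ?thesis
      by (induction J) (auto simp: zero_mem_L L_add)
  qed
qed

end

section \<open>Dividing a pairing by an integer\<close>

text \<open>Only the target is assumed abelian, so commutators in a group of class two and their
  factorizations through abelianizations are both instances.\<close>

locale pairing = G: group G + H: group H + K: comm_group K
  for G :: "('a, 'x) monoid_scheme" and H :: "('b, 'y) monoid_scheme" and K :: "('c, 'z) monoid_scheme" +
  fixes p :: "'a \<Rightarrow> 'b \<Rightarrow> 'c"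
  assumes closed [simp]: "x \<in> carrier G \<Longrightarrow> y \<in> carrier H \<Longrightarrow> p x y \<in> carrier K"
    and mult_left: "\<lbrakk>x \<in> carrier G; x' \<in> carrier G; y \<in> carrier H\<rbrakk> \<Longrightarrow> p (x \<otimes>\<^bsub>G\<^esub> x') y = p x y \<otimes>\<^bsub>K\<^esub> p x' y"
    and mult_right: "\<lbrakk>x \<in> carrier G; y \<in> carrier H; y' \<in> carrier H\<rbrakk> \<Longrightarrow> p x (y \<otimes>\<^bsub>H\<^esub> y') = p x y \<otimes>\<^bsub>K\<^esub> p x y'"
begin

lemma group_hom_left: "y \<in> carrier H \<Longrightarrow> group_hom G K (\<lambda>x. p x y)"
  by unfold_locales (auto simp: hom_def mult_left)

lemma group_hom_right: "x \<in> carrier G \<Longrightarrow> group_hom H K (p x)"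
  by unfold_locales (auto simp: hom_def mult_right)

lemma one_left [simp]: "y \<in> carrier H \<Longrightarrow> p \<one>\<^bsub>G\<^esub> y = \<one>\<^bsub>K\<^esub>"
  using group_hom.hom_one[OF group_hom_left] .

lemma one_right [simp]: "x \<in> carrier G \<Longrightarrow> p x \<one>\<^bsub>H\<^esub> = \<one>\<^bsub>K\<^esub>"
  using group_hom.hom_one[OF group_hom_right] .

lemma inv_left: "x \<in> carrier G \<Longrightarrow> y \<in> carrier H \<Longrightarrow> p (inv\<^bsub>G\<^esub> x) y = inv\<^bsub>K\<^esub> p x y"
  using group_hom.hom_inv[OF group_hom_left] .

lemma inv_right: "x \<in> carrier G \<Longrightarrow> y \<in> carrier H \<Longrightarrow> p x (inv\<^bsub>H\<^esub> y) = inv\<^bsub>K\<^esub> p x y"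
  using group_hom.hom_inv[OF group_hom_right] .

lemma nat_pow_left: "x \<in> carrier G \<Longrightarrow> y \<in> carrier H \<Longrightarrow> p (x [^]\<^bsub>G\<^esub> (k::nat)) y = p x y [^]\<^bsub>K\<^esub> k"
  using group_hom.hom_nat_pow[OF group_hom_left] .

lemma nat_pow_right: "x \<in> carrier G \<Longrightarrow> y \<in> carrier H \<Longrightarrow> p x (y [^]\<^bsub>H\<^esub> (k::nat)) = p x y [^]\<^bsub>K\<^esub> k"
  using group_hom.hom_nat_pow[OF group_hom_right] .

lemma int_pow_left: "x \<in> carrier G \<Longrightarrow> y \<in> carrier H \<Longrightarrow> p (x [^]\<^bsub>G\<^esub> (k::int)) y = p x y [^]\<^bsub>K\<^esub> k"
  using group_hom.hom_int_pow[OF group_hom_left] .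

lemma int_pow_right: "x \<in> carrier G \<Longrightarrow> y \<in> carrier H \<Longrightarrow> p x (y [^]\<^bsub>H\<^esub> (k::int)) = p x y [^]\<^bsub>K\<^esub> k"
  using group_hom.hom_int_pow[OF group_hom_right] .

end

lemma (in group) int_pow_coprime_eq_one:
  fixes j k :: int
  assumes x: "x \<in> carrier G" and "x [^] j = \<one>" "x [^] k = \<one>" "coprime j k"
  shows "x = \<one>"
proof -
  obtain a b where ab: "a * j + b * k = 1"
    using \<open>coprime j k\<close> by (metis bezout_int coprime_imp_gcd_eq_1)
  have "x [^] (a * j) = \<one>" "x [^] (b * k) = \<one>"
    using assms by (metis int_pow_one int_pow_pow mult.commute)+
  then have "x [^] (a * j + b * k) = \<one>"
    using x by (simp add: int_pow_mult)
  then show ?thesis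
    using ab x by (simp add: int_pow_1)
qed

text \<open>In the application \<open>U\<close> and \<open>V\<close> are the abelianizations of A
  and B, \<open>DU\<close> and \<open>DV\<close> the images of D, and \<open>br\<close> comes from
  commutators in M with values in its center. The two power conditions are the centrality conditions
  on the amalgam in this language.\<close>

locale central_pairing = U: comm_group U + V: comm_group V + pairing U V Z br
  for U :: "('a, 'x) monoid_scheme" and V :: "('b, 'y) monoid_scheme" and Z :: "('c, 'z) monoid_scheme"
    and br +
  fixes DU DV and n :: nat
  assumes DU: "subgroup DU U" and DV: "subgroup DV V"
    and power_DU: "\<lbrakk>x \<in> carrier U; x [^]\<^bsub>U\<^esub> n \<in> DU; y \<in> carrier V\<rbrakk> \<Longrightarrow> br (x [^]\<^bsub>U\<^esub> n) y = \<one>\<^bsub>Z\<^esub>"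
    and power_DV: "\<lbrakk>y \<in> carrier V; y [^]\<^bsub>V\<^esub> n \<in> DV; x \<in> carrier U\<rbrakk> \<Longrightarrow> br x (y [^]\<^bsub>V\<^esub> n) = \<one>\<^bsub>Z\<^esub>"
begin

text \<open>With \<open>g = gcd n k\<close>, the value is annihilated by the coprime numbers \<open>n / g\<close> and \<open>k / g\<close>.\<close>

lemma pairing_torsion_eq_one:
  fixes k :: int
  assumes n: "n > 0" and x: "x \<in> carrier U" "x' \<in> carrier U" and y: "y \<in> carrier V"
    and dx: "x' [^]\<^bsub>U\<^esub> n \<otimes>\<^bsub>U\<^esub> inv\<^bsub>U\<^esub> (x [^]\<^bsub>U\<^esub> k) \<in> DU" and dy: "y [^]\<^bsub>V\<^esub> k \<in> DV"
  shows "br x' y [^]\<^bsub>Z\<^esub> n = \<one>\<^bsub>Z\<^esub>"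
proof -
  define g where "g = gcd (int n) k"
  obtain n' k' where nk: "int n = g * n'" "k = g * k'" and cop: "coprime n' k'"
    using n unfolding g_def
    by (metis (no_types, opaque_lifting) coprime_def gcd_coprime_exists gcd_eq_0_iff mult.commute of_nat_0_eq_iff order_less_irrefl)
  have nk': "int n * k' = k * n'" using nk by simp
  then have nk'': "k' * int n = k * n'" by (simp add: mult.commute)
  \<comment> \<open>The exponent \<open>k * n'\<close> equals \<open>n * k'\<close>. Hence this
    power of \<open>y\<close> is an n-th power and also a power of an element of \<open>DV\<close>,
    as \<open>power_DV\<close> requires.\<close>
  have ypow: "br z (y [^]\<^bsub>V\<^esub> (k * n')) = \<one>\<^bsub>Z\<^esub>" if z: "z \<in> carrier U" for z
  proof -
    have "y [^]\<^bsub>V\<^esub> (k * n') = (y [^]\<^bsub>V\<^esub> k') [^]\<^bsub>V\<^esub> n"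
      using y by (metis V.int_pow_pow int_pow_int mult.commute nk')
    moreover have "y [^]\<^bsub>V\<^esub> (k * n') \<in> DV"
      using y dy V.subgroup_int_pow_closed[OF DV dy] by (simp add: V.int_pow_pow[symmetric])
    ultimately show ?thesis
      using power_DV[of "y [^]\<^bsub>V\<^esub> k'" z] y z by simp
  qed
  define d where "d = x' [^]\<^bsub>U\<^esub> n \<otimes>\<^bsub>U\<^esub> inv\<^bsub>U\<^esub> (x [^]\<^bsub>U\<^esub> k)"
  define \<tau> where "\<tau> = br x' y [^]\<^bsub>Z\<^esub> n"
  have d: "d \<in> carrier U" using x by (simp add: d_def)
  have \<tau>: "\<tau> \<in> carrier Z" using x y by (simp add: \<tau>_def)
  \<comment> \<open>Bilinearity moves the exponent \<open>k\<close> from \<open>x\<close> to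
    \<open>y\<close>. One factor can then be killed through \<open>d\<close> in \<open>DU\<close>,
    the other through the k-th power of \<open>y\<close> in \<open>DV\<close>.\<close>
  have \<tau>_eq: "\<tau> = br d y \<otimes>\<^bsub>Z\<^esub> br x (y [^]\<^bsub>V\<^esub> k)"
  proof -
    have "x' [^]\<^bsub>U\<^esub> n = d \<otimes>\<^bsub>U\<^esub> x [^]\<^bsub>U\<^esub> k"
      using x by (simp add: d_def U.m_assoc)
    then show ?thesis
      using x y d by (simp add: \<tau>_def nat_pow_left[symmetric] mult_left int_pow_left int_pow_right)
  qed
  have "\<tau> [^]\<^bsub>Z\<^esub> k' = br x' (y [^]\<^bsub>V\<^esub> (k * n'))"
    using x y by (simp add: \<tau>_def int_pow_right int_pow_int[symmetric] K.int_pow_pow nk')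
  then have 1: "\<tau> [^]\<^bsub>Z\<^esub> k' = \<one>\<^bsub>Z\<^esub>"
    using ypow x by simp
  \<comment> \<open>Because \<open>k * n'\<close> is a multiple of \<open>n\<close>, raising
    \<open>d\<close> to the power \<open>n'\<close> turns it into an n-th power that still lies in
    \<open>DU\<close>, so \<open>power_DU\<close> applies.\<close>
  have "d [^]\<^bsub>U\<^esub> n' = (x' [^]\<^bsub>U\<^esub> n' \<otimes>\<^bsub>U\<^esub> inv\<^bsub>U\<^esub> (x [^]\<^bsub>U\<^esub> k')) [^]\<^bsub>U\<^esub> n"
    using x unfolding d_def
    by (simp add: U.int_pow_distrib U.int_pow_inv U.int_pow_pow int_pow_int[symmetric]
        mult.commute[of "int n"] nk'' flip: U.int_pow_neg)
  then have "br (d [^]\<^bsub>U\<^esub> n') y = \<one>\<^bsub>Z\<^esub>"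
    using power_DU[of "x' [^]\<^bsub>U\<^esub> n' \<otimes>\<^bsub>U\<^esub> inv\<^bsub>U\<^esub> (x [^]\<^bsub>U\<^esub> k')" y] x y
      U.subgroup_int_pow_closed[OF DU, of d n'] dx d_def by simp
  moreover have "br x (y [^]\<^bsub>V\<^esub> k) [^]\<^bsub>Z\<^esub> n' = \<one>\<^bsub>Z\<^esub>"
    using ypow[of x] x y by (simp add: int_pow_right K.int_pow_pow)
  ultimately have "\<tau> [^]\<^bsub>Z\<^esub> n' = \<one>\<^bsub>Z\<^esub>"
    using d x y by (simp add: \<tau>_eq K.int_pow_distrib int_pow_left)
  then show ?thesis
    using K.int_pow_coprime_eq_one[OF \<tau> _ 1 cop] unfolding \<tau>_def by blast
qed

end

section \<open>Free abelian groups on pairs, viewed as integer matrices\<close>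

text \<open>This is the tensor product of two free abelian groups, realized as finitely supported
  integer matrices. The definitions of columns and rows below use \<open>frag_extend\<close> as
  well, which makes their additivity immediate.\<close>

definition frag_tensor :: "('a \<Rightarrow>\<^sub>0 int) \<Rightarrow> ('b \<Rightarrow>\<^sub>0 int) \<Rightarrow> ('a \<times> 'b \<Rightarrow>\<^sub>0 int)" where
  "frag_tensor u v = frag_extend (\<lambda>x. frag_extend (\<lambda>y. frag_of (x, y)) v) u"

definition frag_column :: "'b \<Rightarrow> ('a \<times> 'b \<Rightarrow>\<^sub>0 int) \<Rightarrow> ('a \<Rightarrow>\<^sub>0 int)" where
  "frag_column y f = frag_extend (\<lambda>(x, y'). if y' = y then frag_of x else 0) f"

definition frag_row :: "'a \<Rightarrow> ('a \<times> 'b \<Rightarrow>\<^sub>0 int) \<Rightarrow> ('b \<Rightarrow>\<^sub>0 int)" where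
  "frag_row x f = frag_extend (\<lambda>(x', y). if x' = x then frag_of y else 0) f"

lemma frag_tensor_of [simp]: "frag_tensor (frag_of x) (frag_of y) = frag_of (x, y)"
  by (simp add: frag_tensor_def)

lemma frag_tensor_linear:
  "frag_tensor (u + u') v = frag_tensor u v + frag_tensor u' v"
  "frag_tensor (u - u') v = frag_tensor u v - frag_tensor u' v"
  "frag_tensor (frag_cmul c u) v = frag_cmul c (frag_tensor u v)"
  "frag_tensor u (v + v') = frag_tensor u v + frag_tensor u v'"
  "frag_tensor u (v - v') = frag_tensor u v - frag_tensor u v'"
  "frag_tensor u (frag_cmul c v) = frag_cmul c (frag_tensor u v)"
  unfolding frag_tensor_def
  by (simp_all add: frag_extend_add frag_extend_diff frag_extend_cmul)
     (simp_all add: frag_extend_def frag_cmul_distrib2 frag_cmul_diff_distrib2 sum.distrib sum_subtractf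
        frag_cmul_sum mult.left_commute)

lemma frag_tensor_zero [simp]: "frag_tensor 0 v = 0" "frag_tensor u 0 = 0"
  using frag_tensor_linear(3)[of 0 0 v] frag_tensor_linear(6)[of u 0 0] by simp_all

lemma frag_column_linear:
  "frag_column y (f + f') = frag_column y f + frag_column y f'"
  "frag_column y (f - f') = frag_column y f - frag_column y f'"
  "frag_column y (- f) = - frag_column y f"
  "frag_column y (frag_cmul c f) = frag_cmul c (frag_column y f)"
  "frag_column y 0 = 0"
  "frag_column y (frag_of (x, y')) = (if y' = y then frag_of x else 0)"
  by (simp_all add: frag_column_def frag_extend_add frag_extend_diff frag_extend_minus frag_extend_cmul)

lemma frag_row_linear:
  "frag_row x (f + f') = frag_row x f + frag_row x f'"
  "frag_row x (f - f') = frag_row x f - frag_row x f'"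
  "frag_row x (- f) = - frag_row x f"
  "frag_row x (frag_cmul c f) = frag_cmul c (frag_row x f)"
  "frag_row x 0 = 0"
  "frag_row x (frag_of (x', y)) = (if x' = x then frag_of y else 0)"
  by (simp_all add: frag_row_def frag_extend_add frag_extend_diff frag_extend_minus frag_extend_cmul)

lemma lookup_frag_column: "Poly_Mapping.lookup (frag_column y f) x = Poly_Mapping.lookup f (x, y)"
proof (induction f rule: frag_induction[OF subset_UNIV])
  case (2 p)
  show ?case by (cases p) (simp add: frag_column_linear)
qed (simp_all add: frag_column_linear lookup_minus)

lemma lookup_frag_row: "Poly_Mapping.lookup (frag_row x f) y = Poly_Mapping.lookup f (x, y)"
proof (induction f rule: frag_induction[OF subset_UNIV])
  case (2 p)
  show ?case by (cases p) (simp add: frag_row_linear)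
qed (simp_all add: frag_row_linear lookup_minus)

text \<open>The index set may exceed the support, since the missing entries are 0. This allows all
  columns to be written over one common set, as \<open>system\<close> demands.\<close>

lemma frag_column_eq_sum:
  assumes "finite I" "fst ` Poly_Mapping.keys f \<subseteq> I"
  shows "frag_column y f = (\<Sum>x\<in>I. frag_cmul (Poly_Mapping.lookup f (x, y)) (frag_of x))"
proof (rule poly_mapping_eqI)
  fix x'
  have "x' \<notin> I \<Longrightarrow> Poly_Mapping.lookup f (x', y) = 0"
    using assms by (force simp: in_keys_iff)
  then show "Poly_Mapping.lookup (frag_column y f) x'
      = Poly_Mapping.lookup (\<Sum>x\<in>I. frag_cmul (Poly_Mapping.lookup f (x, y)) (frag_of x)) x'"
    using assms by (simp add: lookup_frag_column lookup_sum if_distrib cong: if_cong)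
qed

lemma frag_row_eq_sum:
  assumes "finite J" "snd ` Poly_Mapping.keys f \<subseteq> J"
  shows "frag_row x f = (\<Sum>y\<in>J. frag_cmul (Poly_Mapping.lookup f (x, y)) (frag_of y))"
proof (rule poly_mapping_eqI)
  fix y'
  have "y' \<notin> J \<Longrightarrow> Poly_Mapping.lookup f (x, y') = 0"
    using assms by (force simp: in_keys_iff)
  then show "Poly_Mapping.lookup (frag_row x f) y'
      = Poly_Mapping.lookup (\<Sum>y\<in>J. frag_cmul (Poly_Mapping.lookup f (x, y)) (frag_of y)) y'"
    using assms by (simp add: lookup_frag_row lookup_sum if_distrib cong: if_cong)
qed

text \<open>A matrix is the sum of its columns, each tensored with a generator. This gives an
  arbitrary element the shape treated by \<open>sum_pairing_system\<close>.\<close>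

lemma sum_frag_tensor_column:
  assumes "finite J" "snd ` Poly_Mapping.keys f \<subseteq> J"
  shows "(\<Sum>y\<in>J. frag_tensor (frag_column y f) (frag_of y)) = f"
  using subset_refl[of "Poly_Mapping.keys f"] 
proof (induction f rule: frag_induction)
  case zero
  then show ?case by (simp add: frag_column_linear)
next
  case (one p)
  then have "snd p \<in> J" using assms by auto
  then show ?case
    using assms(1)
    by (cases p) (simp add: frag_column_linear if_distrib[of "\<lambda>u. frag_tensor u v" for v] cong: if_cong)
next
  case (diff a b)
  then show ?case
    by (simp add: frag_column_linear frag_tensor_linear sum_subtractf)
qed

section \<open>Making a pairing divisible by n in a larger abelian group\<close>

context central_pairing
begin

text \<open>
  \<open>E\<close> is generated by \<open>Z\<close> and by symbols \<open>x \<otimes> y\<close>, bilinear and trivial on \<open>DU\<close> and \<open>DV\<close>, with the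
  relations \<open>n (x \<otimes> y) = n br(x,y)\<close>. In the free abelian group on the pairs, the bilinear relations are
  the sums of a matrix with columns in \<open>KU\<close> and a matrix with rows in \<open>KV\<close>.
\<close>

lemma divide_pairing:
  assumes n: "n > 0"
  obtains E :: "(('a \<times> 'b \<Rightarrow>\<^sub>0 int) \<times> 'c) set monoid" and \<iota> \<mu>
  where "pairing U V E \<mu>" and "\<iota> \<in> mon Z E"
    and "\<And>x y. \<lbrakk>x \<in> carrier U; y \<in> carrier V\<rbrakk> \<Longrightarrow> \<mu> x y [^]\<^bsub>E\<^esub> n = \<iota> (br x y [^]\<^bsub>Z\<^esub> n)"
    and "\<And>x y. \<lbrakk>x \<in> DU; y \<in> carrier V\<rbrakk> \<Longrightarrow> \<mu> x y = \<one>\<^bsub>E\<^esub>"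
    and "\<And>x y. \<lbrakk>x \<in> carrier U; y \<in> DV\<rbrakk> \<Longrightarrow> \<mu> x y = \<one>\<^bsub>E\<^esub>"
proof -
  \<comment> \<open>Generators outside the carriers are sent to the neutral element.\<close>
  define cU where "cU x = (if x \<in> carrier U then x else \<one>\<^bsub>U\<^esub>)" for x
  define cV where "cV y = (if y \<in> carrier V then y else \<one>\<^bsub>V\<^esub>)" for y
  have cU [simp]: "cU x \<in> carrier U" "x \<in> carrier U \<Longrightarrow> cU x = x" for x by (auto simp: cU_def)
  have cV [simp]: "cV y \<in> carrier V" "y \<in> carrier V \<Longrightarrow> cV y = y" for y by (auto simp: cV_def)
  let ?F = "free_Abelian_group (UNIV :: ('a \<times> 'b) set)"
  obtain hU where hU: "hU \<in> hom (free_Abelian_group UNIV) U" "\<And>x. hU (frag_of x) = cU x"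
    using U.free_Abelian_group_universal[of cU UNIV] by (metis cU(1) UNIV_I image_subsetI)
  obtain hV where hV: "hV \<in> hom (free_Abelian_group UNIV) V" "\<And>x. hV (frag_of x) = cV x"
    using V.free_Abelian_group_universal[of cV UNIV] by (metis cV(1) UNIV_I image_subsetI)
  obtain hZ where hZ: "hZ \<in> hom ?F Z" "\<And>p. hZ (frag_of p) = br (cU (fst p)) (cV (snd p))"
    using K.free_Abelian_group_universal[of "\<lambda>p. br (cU (fst p)) (cV (snd p))" UNIV]
    by (metis (no_types, lifting) cU(1) cV(1) closed UNIV_I image_subsetI)
  interpret hU: group_hom "free_Abelian_group UNIV" U hU
    using hU by (simp add: group_hom_def group_hom_axioms_def U.is_group)
  interpret hV: group_hom "free_Abelian_group UNIV" V hV
    using hV by (simp add: group_hom_def group_hom_axioms_def V.is_group)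
  interpret hZ: group_hom ?F Z hZ
    using hZ by (simp add: group_hom_def group_hom_axioms_def K.is_group)
  have hU_simps: "hU u \<in> carrier U" "hU (u + u') = hU u \<otimes>\<^bsub>U\<^esub> hU u'" "hU (- u) = inv\<^bsub>U\<^esub> hU u"
      "hU (u - u') = hU u \<otimes>\<^bsub>U\<^esub> inv\<^bsub>U\<^esub> hU u'" "hU (frag_cmul c u) = hU u [^]\<^bsub>U\<^esub> c" "hU 0 = \<one>\<^bsub>U\<^esub>" for u u' c
    using hU.hom_closed[of u] hU.hom_mult[of u u'] hU.hom_inv[of u] hU.hom_mult[of u "-u'"] hU.hom_inv[of u']
      hU.hom_int_pow[of u c] hU.hom_one by simp_all
  have hV_simps: "hV v \<in> carrier V" "hV (v + v') = hV v \<otimes>\<^bsub>V\<^esub> hV v'" "hV (- v) = inv\<^bsub>V\<^esub> hV v"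
      "hV (v - v') = hV v \<otimes>\<^bsub>V\<^esub> inv\<^bsub>V\<^esub> hV v'" "hV (frag_cmul c v) = hV v [^]\<^bsub>V\<^esub> c" "hV 0 = \<one>\<^bsub>V\<^esub>" for v v' c
    using hV.hom_closed[of v] hV.hom_mult[of v v'] hV.hom_inv[of v] hV.hom_mult[of v "-v'"] hV.hom_inv[of v']
      hV.hom_int_pow[of v c] hV.hom_one by simp_all
  have hZ_simps: "hZ f \<in> carrier Z" "hZ (f + f') = hZ f \<otimes>\<^bsub>Z\<^esub> hZ f'" "hZ (- f) = inv\<^bsub>Z\<^esub> hZ f"
      "hZ (f - f') = hZ f \<otimes>\<^bsub>Z\<^esub> inv\<^bsub>Z\<^esub> hZ f'" "hZ 0 = \<one>\<^bsub>Z\<^esub>" for f f'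
    using hZ.hom_closed[of f] hZ.hom_mult[of f f'] hZ.hom_inv[of f] hZ.hom_mult[of f "-f'"] hZ.hom_inv[of f']
      hZ.hom_one by simp_all
  have hZ_tensor: "hZ (frag_tensor u v) = br (hU u) (hV v)" for u v
  proof (induction u rule: frag_induction[OF subset_UNIV])
    case (2 x)
    show ?case
    proof (induction v rule: frag_induction[OF subset_UNIV])
      case (3 a b)
      then show ?case
        by (simp add: frag_tensor_linear hV_simps hZ_simps hU mult_right inv_right)
    qed (simp_all add: hZ hU hV hZ_simps hV_simps)
  next
    case (3 a b)
    then show ?case
      by (simp add: frag_tensor_linear hV_simps hZ_simps hU_simps mult_left inv_left)
  qed (simp add: hZ_simps hU_simps hV_simps)

  \<comment> \<open>\<open>KU\<close> and \<open>KV\<close> are the relations of the quotients U/DU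
    and V/DV in the chosen generators. With this \<open>L\<close>, the assumption
    \<open>divisor\<close> is exactly \<open>pairing_torsion_eq_one\<close>.\<close>
  define KU where "KU = {u. hU u \<in> DU}"
  define KV where "KV = {v. hV v \<in> DV}"
  define L where "L = {f. hZ f [^]\<^bsub>Z\<^esub> n = \<one>\<^bsub>Z\<^esub>}"
  note DU_closed = subgroup.m_closed[OF DU] subgroup.m_inv_closed[OF DU] subgroup.one_closed[OF DU]
    U.subgroup_int_pow_closed[OF DU]
  note DV_closed = subgroup.m_closed[OF DV] subgroup.m_inv_closed[OF DV] subgroup.one_closed[OF DV]
    V.subgroup_int_pow_closed[OF DV]
  note K_closed = hU_simps hV_simps DU_closed DV_closed
  interpret torsion_pairing frag_tensor KU KV L "int n"
  proof
    fix u w v k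
    assume "frag_cmul (int n) u - frag_cmul k w \<in> KU" "frag_cmul k v \<in> KV"
    then show "frag_tensor u v \<in> L"
      using pairing_torsion_eq_one[OF n, of "hU w" "hU u" "hV v" k]
      by (simp add: KU_def KV_def L_def hZ_tensor hU_simps hV_simps int_pow_int)
  qed (simp_all add: frag_tensor_linear KU_def KV_def L_def K_closed hZ_simps K.nat_pow_distrib)

  define colK where "colK = {X :: 'a \<times> 'b \<Rightarrow>\<^sub>0 int. \<forall>y. frag_column y X \<in> KU}"
  define rowK where "rowK = {Y :: 'a \<times> 'b \<Rightarrow>\<^sub>0 int. \<forall>x. frag_row x Y \<in> KV}"
  \<comment> \<open>The values of \<open>br\<close> to the power \<open>n\<close> kill the n-torsion
    of the tensor product of U/DU and V/DV. The entries of \<open>Y\<close> are the coefficient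
    matrix of the system: comparing columns in the equation for \<open>f\<close> gives the relations
    in \<open>KU\<close>, and the rows of \<open>Y\<close> give those in \<open>KV\<close>.\<close>
  have torsion: "hZ f [^]\<^bsub>Z\<^esub> n = \<one>\<^bsub>Z\<^esub>" if f: "frag_cmul (int n) f = X + Y" and X: "X \<in> colK" and Y: "Y \<in> rowK" for f X Y
  proof -
    define I where "I = fst ` Poly_Mapping.keys Y"
    \<comment> \<open>\<open>J\<close> must also cover the columns of \<open>f\<close>, so that
      \<open>f\<close> is recovered as their sum.\<close>
    define J where "J = snd ` Poly_Mapping.keys Y \<union> snd ` Poly_Mapping.keys f"
    have IJ: "finite I" "finite J" by (simp_all add: I_def J_def)
    have "system I J (\<lambda>x y. Poly_Mapping.lookup Y (x, y)) (\<lambda>y. frag_column y f) frag_of frag_of"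
      unfolding system_def
    proof (intro conjI ballI)
      fix y
      have "frag_cmul (int n) (frag_column y f) - frag_column y Y = frag_column y X"
        using f by (metis add_diff_cancel_right' frag_column_linear(2,4))
      then show "frag_cmul (int n) (frag_column y f) - (\<Sum>i\<in>I. frag_cmul (Poly_Mapping.lookup Y (i, y)) (frag_of i)) \<in> KU"
        using X IJ by (simp add: colK_def I_def flip: frag_column_eq_sum)
    next
      fix x
      have "frag_row x Y = (\<Sum>j\<in>J. frag_cmul (Poly_Mapping.lookup Y (x, j)) (frag_of j))"
        using IJ by (intro frag_row_eq_sum) (auto simp: J_def)
      moreover have "frag_row x Y \<in> KV"
        using Y by (simp add: rowK_def)
      ultimately show "(\<Sum>j\<in>J. frag_cmul (Poly_Mapping.lookup Y (x, j)) (frag_of j)) \<in> KV"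
        by simp
    qed
    then have "(\<Sum>y\<in>J. frag_tensor (frag_column y f) (frag_of y)) \<in> L"
      by (rule sum_pairing_system[OF IJ])
    then show ?thesis
      by (subst (asm) sum_frag_tensor_column) (auto simp: J_def L_def)
  qed

  let ?P = "?F \<times>\<times> Z"
  interpret P: group ?P
    by (simp add: DirProd_group)
  interpret P: comm_group ?P
  proof (rule P.group_comm_groupI)
    show "p \<otimes>\<^bsub>?P\<^esub> q = q \<otimes>\<^bsub>?P\<^esub> p" if "p \<in> carrier ?P" "q \<in> carrier ?P" for p q
      using that by (auto simp: DirProd_def K.m_comm add.commute)
  qed
  have P_simps: "(f, z) \<otimes>\<^bsub>?P\<^esub> (f', z') = (f + f', z \<otimes>\<^bsub>Z\<^esub> z')" "\<one>\<^bsub>?P\<^esub> = (0, \<one>\<^bsub>Z\<^esub>)"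
     "(f, z) \<in> carrier ?P \<longleftrightarrow> z \<in> carrier Z" for f f' z z'
    by (simp_all add: one_DirProd)
  have P_inv: "inv\<^bsub>?P\<^esub> (f, z) = (- f, inv\<^bsub>Z\<^esub> z)" if "z \<in> carrier Z" for f z
    using that by (simp add: inv_DirProd)
  \<comment> \<open>Modulo \<open>H\<close> the multiple of \<open>f\<close> by \<open>n\<close> is
    identified with the n-th power of \<open>hZ f\<close> in \<open>Z\<close>, and the matrices in
    \<open>colK\<close> and \<open>rowK\<close> vanish.\<close>
  define H where "H = {(frag_cmul (int n) f + X + Y, inv\<^bsub>Z\<^esub> (hZ f [^]\<^bsub>Z\<^esub> n)) | f X Y. X \<in> colK \<and> Y \<in> rowK}"
  have colK: "0 \<in> colK" "X \<in> colK \<Longrightarrow> X' \<in> colK \<Longrightarrow> X + X' \<in> colK" "X \<in> colK \<Longrightarrow> - X \<in> colK" for X X'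
    by (simp_all add: colK_def KU_def frag_column_linear K_closed)
  have rowK: "0 \<in> rowK" "X \<in> rowK \<Longrightarrow> X' \<in> rowK \<Longrightarrow> X + X' \<in> rowK" "X \<in> rowK \<Longrightarrow> - X \<in> rowK" for X X'
    by (simp_all add: rowK_def KV_def frag_row_linear K_closed)
  have HI: "(frag_cmul (int n) f + X + Y, inv\<^bsub>Z\<^esub> (hZ f [^]\<^bsub>Z\<^esub> n)) \<in> H" if "X \<in> colK" "Y \<in> rowK" for f X Y
    using that unfolding H_def by blast
  have H: "subgroup H ?P"
  proof (rule P.subgroupI)
    show "H \<subseteq> carrier ?P" by (auto simp: H_def P_simps hZ_simps)
    show "H \<noteq> {}" using HI colK rowK by blast
  next
    fix h assume "h \<in> H"
    then obtain f X Y where h: "h = (frag_cmul (int n) f + X + Y, inv\<^bsub>Z\<^esub> (hZ f [^]\<^bsub>Z\<^esub> n))" and XY: "X \<in> colK" "Y \<in> rowK"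
      unfolding H_def by blast
    have "inv\<^bsub>?P\<^esub> h = (frag_cmul (int n) (- f) + (- X) + (- Y), inv\<^bsub>Z\<^esub> (hZ (- f) [^]\<^bsub>Z\<^esub> n))"
      by (simp add: h P_inv hZ_simps K.nat_pow_inv) (metis add_uminus_conv_diff frag_cmul_cmul frag_cmul_minus_one minus_frag_cmul mult_minus1_right)
    then show "inv\<^bsub>?P\<^esub> h \<in> H"
      using HI colK rowK XY by metis
  next
    fix h h' assume "h \<in> H" "h' \<in> H"
    then obtain f X Y f' X' Y' where h: "h = (frag_cmul (int n) f + X + Y, inv\<^bsub>Z\<^esub> (hZ f [^]\<^bsub>Z\<^esub> n))"
      and h': "h' = (frag_cmul (int n) f' + X' + Y', inv\<^bsub>Z\<^esub> (hZ f' [^]\<^bsub>Z\<^esub> n))"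
      and XY: "X \<in> colK" "Y \<in> rowK" "X' \<in> colK" "Y' \<in> rowK"
      unfolding H_def by blast
    have "h \<otimes>\<^bsub>?P\<^esub> h' = (frag_cmul (int n) (f + f') + (X + X') + (Y + Y'), inv\<^bsub>Z\<^esub> (hZ (f + f') [^]\<^bsub>Z\<^esub> n))"
      by (simp add: h h' hZ_simps K.nat_pow_distrib K.inv_mult frag_cmul_distrib2 algebra_simps K.m_comm)
    then show "h \<otimes>\<^bsub>?P\<^esub> h' \<in> H"
      using HI colK rowK XY by metis
  qed
  interpret H: normal H ?P
    using P.normal_iff_subgroup H by blast
  define E where "E = ?P Mod H"
  interpret E: comm_group E
    unfolding E_def by (rule P.abelian_FactGroup[OF H])
  define \<pi> where "\<pi> p = H #>\<^bsub>?P\<^esub> p" for p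
  interpret \<pi>: group_hom ?P E \<pi>
    using H.r_coset_hom_Mod by unfold_locales (simp add: E_def \<pi>_def[abs_def])
  have \<pi>_eq: "\<pi> p = \<pi> q \<longleftrightarrow> p \<otimes>\<^bsub>?P\<^esub> inv\<^bsub>?P\<^esub> q \<in> H" if "p \<in> carrier ?P" "q \<in> carrier ?P" for p q
    unfolding \<pi>_def using that H
    by (metis H.rcos_module P.is_group P.rcos_self P.repr_independence)
  define \<iota> where "\<iota> z = \<pi> (0, z)" for z
  define \<mu> where "\<mu> x y = \<pi> (frag_of (x, y), \<one>\<^bsub>Z\<^esub>)" for x y
  have \<mu>_eqI: "\<pi> (f, \<one>\<^bsub>Z\<^esub>) = \<pi> (f', \<one>\<^bsub>Z\<^esub>)" if "f - f' \<in> colK \<or> f - f' \<in> rowK" for f f'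
    using that HI[of "f - f'" 0 0] HI[of 0 "f - f'" 0] colK rowK
    by (auto simp: \<pi>_eq P_simps P_inv hZ_simps)
  have "pairing U V E \<mu>"
  proof unfold_locales
    show "\<mu> x y \<in> carrier E" if "x \<in> carrier U" "y \<in> carrier V" for x y
      unfolding \<mu>_def by (rule \<pi>.hom_closed) (simp add: P_simps)
  next
    fix x x' y assume *: "x \<in> carrier U" "x' \<in> carrier U" "y \<in> carrier V"
    \<comment> \<open>Only the column at \<open>y\<close> can be nonzero, and \<open>hU\<close>
      sends it to the neutral element, hence into \<open>DU\<close>.\<close>
    have "frag_of (x \<otimes>\<^bsub>U\<^esub> x', y) - (frag_of (x, y) + frag_of (x', y)) \<in> colK"
      using * by (auto simp: colK_def KU_def frag_column_linear K_closed hU)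
    then have "\<mu> (x \<otimes>\<^bsub>U\<^esub> x') y = \<pi> (frag_of (x, y) + frag_of (x', y), \<one>\<^bsub>Z\<^esub>)"
      unfolding \<mu>_def by (intro \<mu>_eqI) blast
    also have "\<dots> = \<mu> x y \<otimes>\<^bsub>E\<^esub> \<mu> x' y"
      unfolding \<mu>_def by (subst \<pi>.hom_mult[symmetric]) (simp_all add: P_simps)
    finally show "\<mu> (x \<otimes>\<^bsub>U\<^esub> x') y = \<mu> x y \<otimes>\<^bsub>E\<^esub> \<mu> x' y" .
  next
    fix x y y' assume *: "x \<in> carrier U" "y \<in> carrier V" "y' \<in> carrier V"
    have "frag_of (x, y \<otimes>\<^bsub>V\<^esub> y') - (frag_of (x, y) + frag_of (x, y')) \<in> rowK"
      using * by (auto simp: rowK_def KV_def frag_row_linear K_closed hV)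
    then have "\<mu> x (y \<otimes>\<^bsub>V\<^esub> y') = \<pi> (frag_of (x, y) + frag_of (x, y'), \<one>\<^bsub>Z\<^esub>)"
      unfolding \<mu>_def by (intro \<mu>_eqI) blast
    also have "\<dots> = \<mu> x y \<otimes>\<^bsub>E\<^esub> \<mu> x y'"
      unfolding \<mu>_def by (subst \<pi>.hom_mult[symmetric]) (simp_all add: P_simps)
    finally show "\<mu> x (y \<otimes>\<^bsub>V\<^esub> y') = \<mu> x y \<otimes>\<^bsub>E\<^esub> \<mu> x y'" .
  qed
  moreover have "\<iota> \<in> mon Z E"
    unfolding mon_def
  proof (intro CollectI conjI homI inj_onI)
    show "\<iota> z \<in> carrier E" if "z \<in> carrier Z" for z
      unfolding \<iota>_def using that by (intro \<pi>.hom_closed) (simp add: P_simps)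
    show "\<iota> (z \<otimes>\<^bsub>Z\<^esub> z') = \<iota> z \<otimes>\<^bsub>E\<^esub> \<iota> z'" if "z \<in> carrier Z" "z' \<in> carrier Z" for z z'
      unfolding \<iota>_def using that by (subst \<pi>.hom_mult[symmetric]) (simp_all add: P_simps)
    fix z z' assume z: "z \<in> carrier Z" "z' \<in> carrier Z" and "\<iota> z = \<iota> z'"
    then have "(0, z \<otimes>\<^bsub>Z\<^esub> inv\<^bsub>Z\<^esub> z') \<in> H"
      unfolding \<iota>_def by (simp add: \<pi>_eq P_simps P_inv)
    then obtain f X Y where f: "0 = frag_cmul (int n) f + X + Y" and XY: "X \<in> colK" "Y \<in> rowK"
      and z': "z \<otimes>\<^bsub>Z\<^esub> inv\<^bsub>Z\<^esub> z' = inv\<^bsub>Z\<^esub> (hZ f [^]\<^bsub>Z\<^esub> n)"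
      unfolding H_def by blast
    \<comment> \<open>An element of \<open>H\<close> with first component 0 comes from an
      \<open>f\<close> that is n-torsion modulo the bilinear relations. By \<open>torsion\<close>
      its second component is trivial, so \<open>Z\<close> embeds.\<close>
    have "frag_cmul (int n) f = - X + - Y"
      using f[symmetric] by (simp only: add.assoc flip: eq_neg_iff_add_eq_0) (simp add: add.commute)
    then have "hZ f [^]\<^bsub>Z\<^esub> n = \<one>\<^bsub>Z\<^esub>"
      using torsion colK rowK XY by blast
    then show "z = z'"
      using z z' by (metis K.inv_closed K.inv_one K.inv_inv K.inv_equality)
  qed
  moreover have "\<mu> x y [^]\<^bsub>E\<^esub> n = \<iota> (br x y [^]\<^bsub>Z\<^esub> n)" if "x \<in> carrier U" "y \<in> carrier V" for x y
  proof -
    have pow: "(f, \<one>\<^bsub>Z\<^esub>) [^]\<^bsub>?P\<^esub> k = (frag_cmul (int k) f, \<one>\<^bsub>Z\<^esub>)" for f and k :: nat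
      by (induction k) (simp_all add: frag_cmul_distrib add.commute)
    have "\<mu> x y [^]\<^bsub>E\<^esub> n = \<pi> (frag_cmul (int n) (frag_of (x, y)), \<one>\<^bsub>Z\<^esub>)"
      unfolding \<mu>_def pow[symmetric] by (rule \<pi>.hom_nat_pow[symmetric]) (simp add: P_simps)
    also have "\<dots> = \<iota> (br x y [^]\<^bsub>Z\<^esub> n)"
      using HI[of 0 0 "frag_of (x, y)"] colK rowK that
      by (simp add: \<iota>_def \<pi>_eq P_simps P_inv hZ hZ_simps)
    finally show ?thesis .
  qed
  moreover have "\<mu> x y = \<one>\<^bsub>E\<^esub>" if "x \<in> DU" "y \<in> carrier V" for x y
  proof -
    have "frag_of (x, y) - 0 \<in> colK"
      using that subgroup.mem_carrier[OF DU] by (auto simp: colK_def KU_def frag_column_linear K_closed hU)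
    then have "\<mu> x y = \<pi> (0, \<one>\<^bsub>Z\<^esub>)"
      unfolding \<mu>_def by (intro \<mu>_eqI) blast
    then show ?thesis
      using \<pi>.hom_one by (simp add: P_simps)
  qed
  moreover have "\<mu> x y = \<one>\<^bsub>E\<^esub>" if "x \<in> carrier U" "y \<in> DV" for x y
  proof -
    have "frag_of (x, y) - 0 \<in> rowK"
      using that subgroup.mem_carrier[OF DV] by (auto simp: rowK_def KV_def frag_row_linear K_closed hV)
    then have "\<mu> x y = \<pi> (0, \<one>\<^bsub>Z\<^esub>)"
      unfolding \<mu>_def by (intro \<mu>_eqI) blast
    then show ?thesis
      using \<pi>.hom_one by (simp add: P_simps)
  qed
  ultimately show thesis by (rule that)
qed

end

section \<open>Groups of class two\<close>

lemma (in group) commutator_closed [simp]: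
  "x \<in> carrier G \<Longrightarrow> y \<in> carrier G \<Longrightarrow> commutator G x y \<in> carrier G"
  by (simp add: commutator_def)

lemma (in group) mult_commutator:
  assumes "x \<in> carrier G" "y \<in> carrier G"
  shows "y \<otimes> x \<otimes> commutator G x y = x \<otimes> y"
proof -
  have "commutator G x y = inv (y \<otimes> x) \<otimes> (x \<otimes> y)"
    using assms by (simp add: commutator_def inv_mult_group m_assoc)
  then show ?thesis
    using assms m_assoc[of "y \<otimes> x" "inv (y \<otimes> x)" "x \<otimes> y"] by (simp add: r_inv)
qed

lemma (in group) commutator_eqI:
  assumes "x \<in> carrier G" "y \<in> carrier G" "c \<in> carrier G" "y \<otimes> x \<otimes> c = x \<otimes> y"
  shows "commutator G x y = c"
proof -
  have "y \<otimes> x \<otimes> commutator G x y = y \<otimes> x \<otimes> c"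
    using assms by (simp add: mult_commutator)
  then show ?thesis
    using assms(1-3) Units_l_cancel[of "y \<otimes> x" "commutator G x y" c] by simp
qed

lemma (in comm_group) commutator_eq_one:
  "x \<in> carrier G \<Longrightarrow> y \<in> carrier G \<Longrightarrow> commutator G x y = \<one>"
  by (rule commutator_eqI) (simp_all add: m_comm)

lemma (in group_hom) hom_commutator:
  "x \<in> carrier G \<Longrightarrow> y \<in> carrier G \<Longrightarrow> h (commutator G x y) = commutator H (h x) (h y)"
  by (simp add: commutator_def)

lemma (in group) subgroup_center: "subgroup (center G) G"
proof (rule subgroupI)
  show "inv a \<in> center G" if "a \<in> center G" for a
    using that unfolding center_def by (auto) (metis inv_closed inv_inv inv_mult_group)
  show "a \<otimes> b \<in> center G" if "a \<in> center G" "b \<in> center G" for a b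
  proof -
    have ab: "a \<in> carrier G" "b \<in> carrier G"
      using that by (auto simp: center_def)
    have "a \<otimes> b \<otimes> x = x \<otimes> (a \<otimes> b)" if x: "x \<in> carrier G" for x
    proof -
      have comm: "a \<otimes> x = x \<otimes> a" "b \<otimes> x = x \<otimes> b"
        using that \<open>a \<in> center G\<close> \<open>b \<in> center G\<close> by (auto simp: center_def)
      have "a \<otimes> b \<otimes> x = a \<otimes> x \<otimes> b"
        using ab x comm(2) by (simp add: m_assoc)
      then show ?thesis
        using ab x comm(1) by (simp add: m_assoc)
    qed
    with ab show ?thesis by (simp add: center_def)
  qed
  show "center G \<noteq> {}" by (auto simp: center_def)
qed (auto simp: center_def)

lemma (in group) center_commute: "z \<in> center G \<Longrightarrow> x \<in> carrier G \<Longrightarrow> z \<otimes> x = x \<otimes> z"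
  by (simp add: center_def)

lemma (in group) center_carrier: "z \<in> center G \<Longrightarrow> z \<in> carrier G"
  by (simp add: center_def)

lemma (in group) comm_group_center: "comm_group (G\<lparr>carrier := center G\<rparr>)"
proof (rule group.group_comm_groupI[OF subgroup_imp_group[OF subgroup_center]])
  fix x y assume "x \<in> carrier (G\<lparr>carrier := center G\<rparr>)" "y \<in> carrier (G\<lparr>carrier := center G\<rparr>)"
  then show "x \<otimes>\<^bsub>G\<lparr>carrier := center G\<rparr>\<^esub> y = y \<otimes>\<^bsub>G\<lparr>carrier := center G\<rparr>\<^esub> x"
    using center_commute[of x y] center_carrier[of y] by simp
qed

locale class_two_group = group G for G (structure) +
  assumes in_N2: "in_N2 G"
begin

lemma commutator_in_center:
  assumes "x \<in> carrier G" "y \<in> carrier G" shows "commutator G x y \<in> center G"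
proof -
  have "commutator G x y \<in> derived G (carrier G)"
    unfolding derived_def derived_set_eq_commutators[OF is_group] using assms
    by (intro generate.incl) blast
  then show ?thesis
    using in_N2 by (auto simp: in_N2_iff)
qed

lemma commutator_mult_left:
  assumes "x \<in> carrier G" "x' \<in> carrier G" "y \<in> carrier G"
  shows "commutator G (x \<otimes> x') y = commutator G x y \<otimes> commutator G x' y"
proof (rule commutator_eqI)
  let ?c = "commutator G x y" and ?c' = "commutator G x' y"
  have "y \<otimes> (x \<otimes> x') \<otimes> (?c \<otimes> ?c') = y \<otimes> x \<otimes> (x' \<otimes> ?c) \<otimes> ?c'"
    using assms by (simp add: m_assoc)
  also have "\<dots> = (y \<otimes> x \<otimes> ?c) \<otimes> x' \<otimes> ?c'"
    using assms center_commute[OF commutator_in_center[of x y], of x'] by (simp add: m_assoc)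
  also have "\<dots> = x \<otimes> (y \<otimes> x' \<otimes> ?c')"
    using assms by (simp only: mult_commutator[OF assms(1,3)]) (simp add: m_assoc)
  also have "\<dots> = x \<otimes> x' \<otimes> y"
    using assms by (simp only: mult_commutator) (simp only: m_assoc)
  finally show "y \<otimes> (x \<otimes> x') \<otimes> (?c \<otimes> ?c') = x \<otimes> x' \<otimes> y" .
qed (use assms in auto)

lemma commutator_mult_right:
  assumes "x \<in> carrier G" "y \<in> carrier G" "y' \<in> carrier G"
  shows "commutator G x (y \<otimes> y') = commutator G x y \<otimes> commutator G x y'"
proof (rule commutator_eqI)
  let ?c = "commutator G x y" and ?c' = "commutator G x y'"
  have "y \<otimes> y' \<otimes> x \<otimes> (?c \<otimes> ?c') = y \<otimes> (y' \<otimes> x \<otimes> ?c') \<otimes> ?c"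
    using assms center_commute[OF commutator_in_center[of x y], of ?c'] by (simp add: m_assoc)
  also have "\<dots> = y \<otimes> x \<otimes> (y' \<otimes> ?c)"
    using assms by (simp only: mult_commutator) (simp add: m_assoc)
  also have "\<dots> = y \<otimes> x \<otimes> ?c \<otimes> y'"
    using assms center_commute[OF commutator_in_center[of x y], of y'] by (simp add: m_assoc)
  also have "\<dots> = x \<otimes> (y \<otimes> y')"
    using assms by (simp only: mult_commutator) (simp add: m_assoc)
  finally show "y \<otimes> y' \<otimes> x \<otimes> (?c \<otimes> ?c') = x \<otimes> (y \<otimes> y')" .
qed (use assms in auto)

text \<open>The target is the center rather than the whole group, since a pairing needs an abelian
  target. Bilinearity is the centrality of commutators.\<close>

lemma pairing_commutator: "pairing G G (G\<lparr>carrier := center G\<rparr>) (commutator G)"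
proof -
  interpret Z: comm_group "G\<lparr>carrier := center G\<rparr>" by (rule comm_group_center)
  show ?thesis
    by unfold_locales (simp_all add: commutator_in_center commutator_mult_left commutator_mult_right)
qed

end

lemma (in class_two_group) commutator_inverse:
  assumes "x \<in> carrier G" "y \<in> carrier G"
  shows "commutator G y x = inv (commutator G x y)"
  using assms by (simp add: commutator_def inv_mult_group m_assoc)

lemma (in class_two_group) conjugate_eq_mult_commutator:
  assumes "x \<in> carrier G" "y \<in> carrier G"
  shows "x \<otimes> y \<otimes> inv x = y \<otimes> commutator G x y"
proof -
  have "x \<otimes> y = y \<otimes> (x \<otimes> commutator G x y)"
    using assms mult_commutator[of x y] by (simp add: m_assoc)
  also have "\<dots> = y \<otimes> commutator G x y \<otimes> x"
    using assms center_commute[OF commutator_in_center[OF assms] assms(1)] by (simp add: m_assoc)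
  finally show ?thesis
    using assms by (simp add: m_assoc r_inv)
qed

lemma (in class_two_group) conjugates_mult_eq_one:
  assumes carr: "a \<in> carrier G" "b \<in> carrier G" "x \<in> carrier G" "y \<in> carrier G" and z: "z \<in> center G"
    and abz: "a \<otimes> b \<otimes> z = \<one>"
  shows "x \<otimes> a \<otimes> inv x \<otimes> (y \<otimes> b \<otimes> inv y) \<otimes> (z \<otimes> commutator G y a \<otimes> inv (commutator G b x)) = \<one>"
proof -
  interpret C: pairing G G "G\<lparr>carrier := center G\<rparr>" "commutator G" by (rule pairing_commutator)
  have zc: "z \<in> carrier G" using z by (rule center_carrier)
  have one: "commutator G w (a \<otimes> b) = \<one>" if "w \<in> carrier G" for w
  proof (rule commutator_eqI)
    have "a \<otimes> b = inv z"
      using abz carr zc by (metis inv_equality inv_inv m_closed inv_closed)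
    then have "a \<otimes> b \<in> center G"
      using z subgroup.m_inv_closed[OF subgroup_center] by simp
    then show "a \<otimes> b \<otimes> w \<otimes> \<one> = w \<otimes> (a \<otimes> b)"
      using center_commute that center_carrier by simp
  qed (use carr that in auto)
  let ?c = "commutator G"
  have cen: "?c x a \<in> center G" "?c y b \<in> center G" "?c y a \<in> center G" "?c x b \<in> center G"
    using carr by (simp_all add: commutator_in_center)
  have "x \<otimes> a \<otimes> inv x \<otimes> (y \<otimes> b \<otimes> inv y) \<otimes> (z \<otimes> ?c y a \<otimes> inv (?c b x))
      = (a \<otimes> ?c x a) \<otimes> (b \<otimes> ?c y b) \<otimes> (z \<otimes> ?c y a \<otimes> ?c x b)"
    using carr by (simp add: conjugate_eq_mult_commutator commutator_inverse[of b x])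
  also have "\<dots> = a \<otimes> (?c x a \<otimes> b) \<otimes> (?c y b \<otimes> z) \<otimes> ?c y a \<otimes> ?c x b"
    using carr zc by (simp add: m_assoc)
  also have "\<dots> = a \<otimes> b \<otimes> (?c x a \<otimes> z) \<otimes> ?c y b \<otimes> ?c y a \<otimes> ?c x b"
    using carr zc center_commute[OF cen(1), of b] center_commute[OF cen(2), of z] by (simp add: m_assoc)
  also have "\<dots> = (a \<otimes> b \<otimes> z) \<otimes> (?c x a \<otimes> (?c y b \<otimes> ?c y a \<otimes> ?c x b))"
    using carr zc center_commute[OF cen(1), of z] by (simp add: m_assoc)
  also have "\<dots> = ?c x a \<otimes> ((?c y b \<otimes> ?c y a) \<otimes> ?c x b)"
    using abz carr by simp
  also have "\<dots> = (?c x a \<otimes> ?c x b) \<otimes> (?c y a \<otimes> ?c y b)"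
    using carr center_commute[OF cen(4), of "?c y b \<otimes> ?c y a"] center_commute[OF cen(2), of "?c y a"]
    by (simp add: m_assoc)
  also have "\<dots> = \<one>"
    using carr one by (simp flip: commutator_mult_right)
  finally show ?thesis .
qed

lemma in_variety_imp_N2: "in_variety m n G \<Longrightarrow> in_N2 G"
  by (simp add: in_variety_def in_N2_def)

lemma in_variety_imp_class_two: "in_variety m n G \<Longrightarrow> class_two_group G"
  by (simp add: class_two_group_def class_two_group_axioms_def in_variety_imp_N2) (simp add: in_variety_def)

lemma in_variety_epi:
  assumes G: "in_variety m n G" and H: "group H" and h: "h \<in> epi G H"
  shows "in_variety m n H"
proof -
  interpret group_hom G H h
    using G H h by (simp add: group_hom_def group_hom_axioms_def epi_def in_variety_def)
  have surj: "\<exists>x\<in>carrier G. y = h x" if "y \<in> carrier H" for y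
    using that h by (auto simp: epi_def)
  show ?thesis
    unfolding in_variety_def
  proof (intro conjI ballI)
    fix x assume "x \<in> carrier H"
    then obtain x' where "x' \<in> carrier G" "x = h x'" using surj by blast
    then show "x [^]\<^bsub>H\<^esub> m = \<one>\<^bsub>H\<^esub>"
      using G by (simp add: in_variety_def flip: hom_nat_pow)
  next
    fix x y assume "x \<in> carrier H" "y \<in> carrier H"
    then obtain x' y' where "x' \<in> carrier G" "x = h x'" "y' \<in> carrier G" "y = h y'" using surj by metis
    then show "commutator H x y [^]\<^bsub>H\<^esub> n = \<one>\<^bsub>H\<^esub>"
      using G by (simp add: in_variety_def flip: hom_nat_pow hom_commutator)
  next
    fix x y z assume "x \<in> carrier H" "y \<in> carrier H" "z \<in> carrier H"
    then obtain x' y' z' where "x' \<in> carrier G" "x = h x'" "y' \<in> carrier G" "y = h y'"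
      "z' \<in> carrier G" "z = h z'" using surj by metis
    then show "commutator H (commutator H x y) z = \<one>\<^bsub>H\<^esub>"
      using G by (simp add: in_variety_def flip: hom_commutator)
  qed (rule H)
qed

text \<open>Both \<open>m\<close> and \<open>m choose 2\<close> occur as exponents in the m-th power
  of an element of a twisted product. For even m the second is (m/2)(m-1), which accounts for the
  factor \<open>gcd 2 m\<close>.\<close>

lemma dvd_choose_two:
  fixes m n :: nat
  assumes "n dvd m div gcd 2 m"
  shows "n dvd m" "n dvd m choose 2"
proof -
  show "n dvd m"
    using assms by (metis dvd_div_mult_self dvd_triv_left dvd_trans gcd_dvd2)
  show "n dvd m choose 2"
  proof (cases "even m")
    case True
    then obtain q where q: "m = 2 * q" by blast
    then have "n dvd q" using assms by (simp add: gcd_nat.absorb1)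
    then show ?thesis
      using q by (simp add: choose_two)
  next
    case False
    then obtain r where r: "m = 2 * r + 1" using oddE by blast
    then have "m choose 2 = m * r" by (simp add: choose_two)
    then show ?thesis using \<open>n dvd m\<close> by simp
  qed
qed

section \<open>Central products with prescribed mixed commutators\<close>

text \<open>The commutator of \<open>b\<close> and \<open>a\<close> in the twisted product is \<open>\<kappa> a b\<close>.\<close>

definition twisted_product ::
  "('a, 'x) monoid_scheme \<Rightarrow> ('b, 'y) monoid_scheme \<Rightarrow> ('c, 'z) monoid_scheme \<Rightarrow> ('a \<Rightarrow> 'b \<Rightarrow> 'c)
    \<Rightarrow> ('a \<times> 'b \<times> 'c) monoid" where
  "twisted_product A B E \<kappa> = \<lparr>carrier = carrier A \<times> carrier B \<times> carrier E,
     mult = (\<lambda>(a, b, e) (a', b', e'). (a \<otimes>\<^bsub>A\<^esub> a', b \<otimes>\<^bsub>B\<^esub> b', e \<otimes>\<^bsub>E\<^esub> e' \<otimes>\<^bsub>E\<^esub> \<kappa> a' b)),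
     one = (\<one>\<^bsub>A\<^esub>, \<one>\<^bsub>B\<^esub>, \<one>\<^bsub>E\<^esub>)\<rparr>"

lemma twisted_product_simps [simp]:
  "carrier (twisted_product A B E \<kappa>) = carrier A \<times> carrier B \<times> carrier E"
  "(a, b, e) \<otimes>\<^bsub>twisted_product A B E \<kappa>\<^esub> (a', b', e') = (a \<otimes>\<^bsub>A\<^esub> a', b \<otimes>\<^bsub>B\<^esub> b', e \<otimes>\<^bsub>E\<^esub> e' \<otimes>\<^bsub>E\<^esub> \<kappa> a' b)"
  "\<one>\<^bsub>twisted_product A B E \<kappa>\<^esub> = (\<one>\<^bsub>A\<^esub>, \<one>\<^bsub>B\<^esub>, \<one>\<^bsub>E\<^esub>)"
  by (simp_all add: twisted_product_def)

context pairing
begin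

lemma group_twisted_product: "group (twisted_product G H K p)"
proof (rule groupI)
  fix x y z
  assume "x \<in> carrier (twisted_product G H K p)" "y \<in> carrier (twisted_product G H K p)"
    "z \<in> carrier (twisted_product G H K p)"
  then show "x \<otimes>\<^bsub>twisted_product G H K p\<^esub> y \<otimes>\<^bsub>twisted_product G H K p\<^esub> z =
      x \<otimes>\<^bsub>twisted_product G H K p\<^esub> (y \<otimes>\<^bsub>twisted_product G H K p\<^esub> z)"
    by (auto simp: G.m_assoc H.m_assoc mult_left mult_right K.m_ac)
next
  fix x assume "x \<in> carrier (twisted_product G H K p)"
  then obtain a b e where x: "x = (a, b, e)" "a \<in> carrier G" "b \<in> carrier H" "e \<in> carrier K" by auto
  \<comment> \<open>The product carries the twist of \<open>a\<close> with the inverse of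
    \<open>b\<close>; the factor \<open>p a b\<close> in the witness cancels it.\<close>
  then have "(inv\<^bsub>G\<^esub> a, inv\<^bsub>H\<^esub> b, inv\<^bsub>K\<^esub> e \<otimes>\<^bsub>K\<^esub> p a b) \<otimes>\<^bsub>twisted_product G H K p\<^esub> x = \<one>\<^bsub>twisted_product G H K p\<^esub>"
    by (simp add: inv_right K.m_ac K.r_inv)
  moreover have "(inv\<^bsub>G\<^esub> a, inv\<^bsub>H\<^esub> b, inv\<^bsub>K\<^esub> e \<otimes>\<^bsub>K\<^esub> p a b) \<in> carrier (twisted_product G H K p)"
    using x by simp
  ultimately show "\<exists>y\<in>carrier (twisted_product G H K p). y \<otimes>\<^bsub>twisted_product G H K p\<^esub> x = \<one>\<^bsub>twisted_product G H K p\<^esub>"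
    by blast
qed auto

text \<open>Passing from exponent k to k+1 moves \<open>a\<close> past the k-th power of
  \<open>b\<close> and contributes \<open>p a b\<close> to the power k; the exponents 0, ..., k-1
  add up to \<open>k choose 2\<close>.\<close>

lemma twisted_product_pow:
  fixes k :: nat
  assumes "a \<in> carrier G" "b \<in> carrier H" "e \<in> carrier K"
  shows "(a, b, e) [^]\<^bsub>twisted_product G H K p\<^esub> k
      = (a [^]\<^bsub>G\<^esub> k, b [^]\<^bsub>H\<^esub> k, e [^]\<^bsub>K\<^esub> k \<otimes>\<^bsub>K\<^esub> p a b [^]\<^bsub>K\<^esub> (k choose 2))"
proof (induction k)
  case (Suc k)
  have "p a b [^]\<^bsub>K\<^esub> (Suc k choose 2) = p a b [^]\<^bsub>K\<^esub> (k choose 2) \<otimes>\<^bsub>K\<^esub> p a b [^]\<^bsub>K\<^esub> k"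
    using assms by (simp add: K.nat_pow_mult numeral_2_eq_2 add.commute)
  then show ?case
    using Suc assms by (simp add: nat_pow_right K.m_ac)
qed (use assms in \<open>simp add: numeral_2_eq_2\<close>)

lemma commutator_eq_one_left:
  "x \<in> carrier G \<Longrightarrow> x' \<in> carrier G \<Longrightarrow> y \<in> carrier H \<Longrightarrow> p (commutator G x x') y = \<one>\<^bsub>K\<^esub>"
  using group_hom.hom_commutator[OF group_hom_left] by (simp add: K.commutator_eq_one)

lemma commutator_eq_one_right:
  "x \<in> carrier G \<Longrightarrow> y \<in> carrier H \<Longrightarrow> y' \<in> carrier H \<Longrightarrow> p x (commutator H y y') = \<one>\<^bsub>K\<^esub>"
  using group_hom.hom_commutator[OF group_hom_right] by (simp add: K.commutator_eq_one)

text \<open>The pairing vanishes on commutators in either argument, as its target is abelian. Hence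
  commutators are central and their n-th powers are computed componentwise; for m-th powers the
  divisibilities of \<open>dvd_choose_two\<close> suffice.\<close>

lemma in_variety_twisted_product:
  assumes mn: "n dvd m div gcd 2 m" and G: "in_variety m n G" and H: "in_variety m n H"
    and K: "\<And>e. e \<in> carrier K \<Longrightarrow> e [^]\<^bsub>K\<^esub> n = \<one>\<^bsub>K\<^esub>"
  shows "in_variety m n (twisted_product G H K p)"
proof -
  let ?P = "twisted_product G H K p"
  interpret P: group ?P by (rule group_twisted_product)
  interpret G2: class_two_group G using G by (rule in_variety_imp_class_two)
  interpret H2: class_two_group H using H by (rule in_variety_imp_class_two)
  interpret fst: group_hom ?P G fst
    by unfold_locales (auto simp: hom_def)
  interpret snd: group_hom ?P H "fst \<circ> snd"
    by unfold_locales (auto simp: hom_def)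
  have K_dvd: "e [^]\<^bsub>K\<^esub> k = \<one>\<^bsub>K\<^esub>" if "e \<in> carrier K" "n dvd k" for e and k :: nat
    using that K by (metis dvdE K.nat_pow_one K.nat_pow_pow)
  \<comment> \<open>The projections determine the first two components. Of the third, only
    membership in \<open>K\<close> matters.\<close>
  have comm: "\<exists>e\<in>carrier K. commutator ?P (a, b, c) (a', b', c') = (commutator G a a', commutator H b b', e)"
    if "(a, b, c) \<in> carrier ?P" "(a', b', c') \<in> carrier ?P" for a b c a' b' c'
    using that fst.hom_commutator[of "(a, b, c)" "(a', b', c')"] snd.hom_commutator[of "(a, b, c)" "(a', b', c')"]
      P.commutator_closed[of "(a, b, c)" "(a', b', c')"]
    by (cases "commutator ?P (a, b, c) (a', b', c')") simp
  show ?thesis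
    unfolding in_variety_def
  proof (intro conjI ballI)
    fix x assume "x \<in> carrier ?P"
    then show "x [^]\<^bsub>?P\<^esub> m = \<one>\<^bsub>?P\<^esub>"
      using G H K_dvd dvd_choose_two[OF mn] by (cases x) (simp add: twisted_product_pow in_variety_def)
  next
    fix x y assume xy: "x \<in> carrier ?P" "y \<in> carrier ?P"
    obtain a b c a' b' c' where [simp]: "x = (a, b, c)" "y = (a', b', c')" by (metis surj_pair)
    obtain e where e: "e \<in> carrier K" "commutator ?P x y = (commutator G a a', commutator H b b', e)"
      using comm xy by force
    show "commutator ?P x y [^]\<^bsub>?P\<^esub> n = \<one>\<^bsub>?P\<^esub>"
      using xy G H e K by (simp add: twisted_product_pow commutator_eq_one_left in_variety_def)
    fix z assume z: "z \<in> carrier ?P"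
    obtain a'' b'' c'' where [simp]: "z = (a'', b'', c'')" by (metis surj_pair)
    show "commutator ?P (commutator ?P x y) z = \<one>\<^bsub>?P\<^esub>"
    proof (rule P.commutator_eqI[OF P.commutator_closed[OF xy] z P.one_closed])
      show "z \<otimes>\<^bsub>?P\<^esub> commutator ?P x y \<otimes>\<^bsub>?P\<^esub> \<one>\<^bsub>?P\<^esub> = commutator ?P x y \<otimes>\<^bsub>?P\<^esub> z"
        using xy z e G.center_commute[OF G2.commutator_in_center, of a a' a'']
          H.center_commute[OF H2.commutator_in_center, of b b' b'']
        by (simp add: commutator_eq_one_left commutator_eq_one_right K.m_comm)
    qed
  qed (rule group_twisted_product)
qed

end

text \<open>
  \<open>NA\<close> and \<open>NB\<close> play the role of \<open>DA'\<close> and \<open>DB'\<close>. On them \<open>\<kappa>\<close> agrees with the commutator of \<open>M\<close>,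
  so that \<open>(a, b, \<iota> z) \<mapsto> f a \<otimes> g b \<otimes> z\<close> is a homomorphism on a subgroup of the twisted product; its
  kernel \<open>N\<close> contains the elements identifying the two copies of \<open>D\<close>.
\<close>

locale gluing = A: group A + B: group B + K: comm_group K + pairing A B K \<kappa>
    + M: class_two_group M + f: group_hom A M f + g: group_hom B M g
  for A :: "('a, 'x) monoid_scheme" and B :: "('b, 'y) monoid_scheme" and K :: "('e, 'w) monoid_scheme"
    and \<kappa> and M :: "('c, 'z) monoid_scheme" and f g +
  fixes Z :: "'c set" and \<iota> :: "'c \<Rightarrow> 'e" and NA :: "'a set" and NB :: "'b set"
  assumes inj_f: "inj_on f (carrier A)" and inj_g: "inj_on g (carrier B)"
    and Z_subgroup: "subgroup Z M" and Z_center: "Z \<subseteq> center M"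
    and \<iota>: "\<iota> \<in> mon (M\<lparr>carrier := Z\<rparr>) K"
    and NA: "NA \<lhd> A" and NB: "NB \<lhd> B"
    and commutator_left: "\<lbrakk>a \<in> NA; b \<in> carrier B\<rbrakk> \<Longrightarrow> commutator M (g b) (f a) \<in> Z \<and> \<kappa> a b = \<iota> (commutator M (g b) (f a))"
    and commutator_right: "\<lbrakk>a \<in> carrier A; b \<in> NB\<rbrakk> \<Longrightarrow> commutator M (g b) (f a) \<in> Z \<and> \<kappa> a b = \<iota> (commutator M (g b) (f a))"
begin

definition N :: "('a \<times> 'b \<times> 'e) set" where
  "N = {(a, b, \<iota> z) | a b z. a \<in> NA \<and> b \<in> NB \<and> z \<in> Z \<and> f a \<otimes>\<^bsub>M\<^esub> g b \<otimes>\<^bsub>M\<^esub> z = \<one>\<^bsub>M\<^esub>}"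

abbreviation "P \<equiv> twisted_product A B K \<kappa>"

lemma NI: "\<lbrakk>a \<in> NA; b \<in> NB; z \<in> Z; f a \<otimes>\<^bsub>M\<^esub> g b \<otimes>\<^bsub>M\<^esub> z = \<one>\<^bsub>M\<^esub>\<rbrakk> \<Longrightarrow> (a, b, \<iota> z) \<in> N"
  unfolding N_def by blast

lemma NA_subgroup: "subgroup NA A" and NB_subgroup: "subgroup NB B"
  using NA NB by (simp_all add: normal_imp_subgroup)

lemma mem_carrier: "a \<in> NA \<Longrightarrow> a \<in> carrier A" "b \<in> NB \<Longrightarrow> b \<in> carrier B" "z \<in> Z \<Longrightarrow> z \<in> carrier M"
  "z \<in> Z \<Longrightarrow> \<iota> z \<in> carrier K"
  using subgroup.mem_carrier[OF NA_subgroup] subgroup.mem_carrier[OF NB_subgroup]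
    subgroup.mem_carrier[OF Z_subgroup] \<iota> by (auto simp: mon_def hom_def)

lemma \<iota>_mult: "z \<in> Z \<Longrightarrow> z' \<in> Z \<Longrightarrow> \<iota> (z \<otimes>\<^bsub>M\<^esub> z') = \<iota> z \<otimes>\<^bsub>K\<^esub> \<iota> z'"
  using \<iota> by (simp add: mon_def hom_def)

lemma \<iota>_one: "\<iota> \<one>\<^bsub>M\<^esub> = \<one>\<^bsub>K\<^esub>"
proof -
  interpret Z: group "M\<lparr>carrier := Z\<rparr>" by (rule M.subgroup_imp_group[OF Z_subgroup])
  interpret \<iota>: group_hom "M\<lparr>carrier := Z\<rparr>" K \<iota>
    using \<iota> by unfold_locales (simp add: mon_def)
  show ?thesis using \<iota>.hom_one by simp
qed

lemma \<iota>_inv: "z \<in> Z \<Longrightarrow> \<iota> (inv\<^bsub>M\<^esub> z) = inv\<^bsub>K\<^esub> \<iota> z"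
  by (metis K.inv_equality M.l_inv \<iota>_mult \<iota>_one mem_carrier(3,4) subgroup.m_inv_closed[OF Z_subgroup])

lemma \<iota>_eq_one: "z \<in> Z \<Longrightarrow> \<iota> z = \<one>\<^bsub>K\<^esub> \<Longrightarrow> z = \<one>\<^bsub>M\<^esub>"
  using \<iota> \<iota>_one inj_onD[of \<iota> Z z "\<one>\<^bsub>M\<^esub>"] subgroup.one_closed[OF Z_subgroup] by (simp add: mon_def)

lemma Z_commute: "z \<in> Z \<Longrightarrow> x \<in> carrier M \<Longrightarrow> z \<otimes>\<^bsub>M\<^esub> x = x \<otimes>\<^bsub>M\<^esub> z"
  using Z_center M.center_commute by blast

lemma subgroup_N: "subgroup N P"
proof (rule group.subgroupI[OF group_twisted_product])
  show "N \<subseteq> carrier P"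
    unfolding N_def using mem_carrier by auto
  show "N \<noteq> {}"
    using NI[of "\<one>\<^bsub>A\<^esub>" "\<one>\<^bsub>B\<^esub>" "\<one>\<^bsub>M\<^esub>"] subgroup.one_closed[OF NA_subgroup] subgroup.one_closed[OF NB_subgroup]
      subgroup.one_closed[OF Z_subgroup] by auto
next
  fix h assume "h \<in> N"
  then obtain a b z where h: "h = (a, b, \<iota> z)" "a \<in> NA" "b \<in> NB" "z \<in> Z" "f a \<otimes>\<^bsub>M\<^esub> g b \<otimes>\<^bsub>M\<^esub> z = \<one>\<^bsub>M\<^esub>"
    unfolding N_def by blast
  note carr = mem_carrier(1)[OF h(2)] mem_carrier(2)[OF h(3)] mem_carrier(3,4)[OF h(4)]
  let ?c = "commutator M (g b) (f a)"
  have c: "?c \<in> Z" "\<kappa> a b = \<iota> ?c" using commutator_left h carr by auto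
  \<comment> \<open>The inverse in the twisted product carries an extra \<open>\<kappa> a b\<close>,
    which on \<open>NA\<close> is the image of the commutator \<open>?c\<close>. So the inverse
    again has the form required by \<open>N\<close>.\<close>
  have "inv\<^bsub>P\<^esub> h = (inv\<^bsub>A\<^esub> a, inv\<^bsub>B\<^esub> b, \<iota> (inv\<^bsub>M\<^esub> z \<otimes>\<^bsub>M\<^esub> ?c))"
  proof (rule group.inv_equality[OF group_twisted_product])
    show "(inv\<^bsub>A\<^esub> a, inv\<^bsub>B\<^esub> b, \<iota> (inv\<^bsub>M\<^esub> z \<otimes>\<^bsub>M\<^esub> ?c)) \<otimes>\<^bsub>P\<^esub> h = \<one>\<^bsub>P\<^esub>"
      using h c carr
      by (simp add: \<iota>_mult \<iota>_inv subgroup.m_inv_closed[OF Z_subgroup] inv_right K.m_ac mem_carrier(4) flip: c(2))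
        (simp add: mem_carrier(4) K.r_inv flip: K.inv_mult K.m_assoc)
  qed (use h carr c in \<open>simp_all add: \<iota>_mult \<iota>_inv subgroup.m_inv_closed[OF Z_subgroup] mem_carrier(4)\<close>)
  moreover have "(inv\<^bsub>A\<^esub> a, inv\<^bsub>B\<^esub> b, \<iota> (inv\<^bsub>M\<^esub> z \<otimes>\<^bsub>M\<^esub> ?c)) \<in> N"
  proof (rule NI)
    show "inv\<^bsub>A\<^esub> a \<in> NA" "inv\<^bsub>B\<^esub> b \<in> NB" "inv\<^bsub>M\<^esub> z \<otimes>\<^bsub>M\<^esub> ?c \<in> Z"
      using h c NA_subgroup NB_subgroup Z_subgroup by (auto simp: subgroup.m_inv_closed subgroup.m_closed)
    have "f a \<otimes>\<^bsub>M\<^esub> g b = inv\<^bsub>M\<^esub> z"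
      using h carr by (metis M.inv_equality M.inv_inv M.m_closed M.inv_closed f.hom_closed g.hom_closed)
    then have "inv\<^bsub>M\<^esub> z \<otimes>\<^bsub>M\<^esub> ?c = g b \<otimes>\<^bsub>M\<^esub> f a"
      using M.mult_commutator[of "g b" "f a"] carr by simp
    moreover have "f (inv\<^bsub>A\<^esub> a) \<otimes>\<^bsub>M\<^esub> g (inv\<^bsub>B\<^esub> b) = inv\<^bsub>M\<^esub> (g b \<otimes>\<^bsub>M\<^esub> f a)"
      using carr by (simp add: M.inv_mult_group)
    ultimately show "f (inv\<^bsub>A\<^esub> a) \<otimes>\<^bsub>M\<^esub> g (inv\<^bsub>B\<^esub> b) \<otimes>\<^bsub>M\<^esub> (inv\<^bsub>M\<^esub> z \<otimes>\<^bsub>M\<^esub> ?c) = \<one>\<^bsub>M\<^esub>"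
      using carr by (simp only:) (simp add: M.l_inv)
  qed
  ultimately show "inv\<^bsub>P\<^esub> h \<in> N" by simp
next
  fix h h' assume "h \<in> N" "h' \<in> N"
  then obtain a b z a' b' z' where
    h: "h = (a, b, \<iota> z)" "a \<in> NA" "b \<in> NB" "z \<in> Z" "f a \<otimes>\<^bsub>M\<^esub> g b \<otimes>\<^bsub>M\<^esub> z = \<one>\<^bsub>M\<^esub>" and
    h': "h' = (a', b', \<iota> z')" "a' \<in> NA" "b' \<in> NB" "z' \<in> Z" "f a' \<otimes>\<^bsub>M\<^esub> g b' \<otimes>\<^bsub>M\<^esub> z' = \<one>\<^bsub>M\<^esub>"
    unfolding N_def by blast
  note carr = mem_carrier(1)[OF h(2)] mem_carrier(2)[OF h(3)] mem_carrier(3,4)[OF h(4)]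
     mem_carrier(1)[OF h'(2)] mem_carrier(2)[OF h'(3)] mem_carrier(3,4)[OF h'(4)]
  let ?c = "commutator M (g b) (f a')"
  have c: "?c \<in> Z" "\<kappa> a' b = \<iota> ?c" using commutator_left h' carr by auto
  have zc: "z \<otimes>\<^bsub>M\<^esub> z' \<in> Z" using h h' Z_subgroup by (simp add: subgroup.m_closed)
  \<comment> \<open>The twist \<open>\<kappa> a' b\<close> of the product is the image of
    \<open>?c\<close>, which is precisely the commutator needed to exchange \<open>f a'\<close> and
    \<open>g b\<close> in \<open>M\<close>.\<close>
  have "(a \<otimes>\<^bsub>A\<^esub> a', b \<otimes>\<^bsub>B\<^esub> b', \<iota> (z \<otimes>\<^bsub>M\<^esub> z' \<otimes>\<^bsub>M\<^esub> ?c)) \<in> N"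
  proof (rule NI)
    show "a \<otimes>\<^bsub>A\<^esub> a' \<in> NA" "b \<otimes>\<^bsub>B\<^esub> b' \<in> NB" "z \<otimes>\<^bsub>M\<^esub> z' \<otimes>\<^bsub>M\<^esub> ?c \<in> Z"
      using h h' c NA_subgroup NB_subgroup Z_subgroup by (auto simp: subgroup.m_closed)
    have "f (a \<otimes>\<^bsub>A\<^esub> a') \<otimes>\<^bsub>M\<^esub> g (b \<otimes>\<^bsub>B\<^esub> b') \<otimes>\<^bsub>M\<^esub> (z \<otimes>\<^bsub>M\<^esub> z' \<otimes>\<^bsub>M\<^esub> ?c)
       = f a \<otimes>\<^bsub>M\<^esub> f a' \<otimes>\<^bsub>M\<^esub> g b \<otimes>\<^bsub>M\<^esub> (g b' \<otimes>\<^bsub>M\<^esub> (z \<otimes>\<^bsub>M\<^esub> z') \<otimes>\<^bsub>M\<^esub> ?c)"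
      using carr c by (simp add: M.m_assoc)
    also have "\<dots> = f a \<otimes>\<^bsub>M\<^esub> (f a' \<otimes>\<^bsub>M\<^esub> g b \<otimes>\<^bsub>M\<^esub> ?c) \<otimes>\<^bsub>M\<^esub> g b' \<otimes>\<^bsub>M\<^esub> (z \<otimes>\<^bsub>M\<^esub> z')"
      using carr Z_commute[OF c(1), of "g b' \<otimes>\<^bsub>M\<^esub> (z \<otimes>\<^bsub>M\<^esub> z')"] by (simp add: M.m_assoc)
    also have "\<dots> = f a \<otimes>\<^bsub>M\<^esub> g b \<otimes>\<^bsub>M\<^esub> (f a' \<otimes>\<^bsub>M\<^esub> g b' \<otimes>\<^bsub>M\<^esub> z) \<otimes>\<^bsub>M\<^esub> z'"
      using carr by (simp add: M.mult_commutator) (simp add: M.m_assoc)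
    also have "\<dots> = (f a \<otimes>\<^bsub>M\<^esub> g b \<otimes>\<^bsub>M\<^esub> z) \<otimes>\<^bsub>M\<^esub> (f a' \<otimes>\<^bsub>M\<^esub> g b' \<otimes>\<^bsub>M\<^esub> z')"
      using carr by (simp only: Z_commute[OF h(4), of "f a' \<otimes>\<^bsub>M\<^esub> g b'", symmetric] f.hom_closed g.hom_closed M.m_closed)
        (simp add: M.m_assoc)
    finally show "f (a \<otimes>\<^bsub>A\<^esub> a') \<otimes>\<^bsub>M\<^esub> g (b \<otimes>\<^bsub>B\<^esub> b') \<otimes>\<^bsub>M\<^esub> (z \<otimes>\<^bsub>M\<^esub> z' \<otimes>\<^bsub>M\<^esub> ?c) = \<one>\<^bsub>M\<^esub>"
      using h h' by simp
  qed
  then show "h \<otimes>\<^bsub>P\<^esub> h' \<in> N"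
    using h h' c zc by (simp add: \<iota>_mult)
qed

text \<open>Conjugation by \<open>(p, q, e)\<close> changes the third component by
  \<open>\<kappa> a q\<close> and the inverse of \<open>\<kappa> p b\<close>. Both are images of
  commutators in \<open>Z\<close>, because \<open>a\<close> lies in \<open>NA\<close> and
  \<open>b\<close> in \<open>NB\<close>, so \<open>conjugates_mult_eq_one\<close> applies.\<close>

lemma normal_N: "N \<lhd> P"
proof -
  interpret P: group P by (rule group_twisted_product)
  have "x \<otimes>\<^bsub>P\<^esub> h \<otimes>\<^bsub>P\<^esub> inv\<^bsub>P\<^esub> x \<in> N" if x: "x \<in> carrier P" and "h \<in> N" for x h
  proof -
    obtain p q e where x_eq: "x = (p, q, e)" and pqe: "p \<in> carrier A" "q \<in> carrier B" "e \<in> carrier K"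
      using x by auto
    obtain a b z where h: "h = (a, b, \<iota> z)" "a \<in> NA" "b \<in> NB" "z \<in> Z" "f a \<otimes>\<^bsub>M\<^esub> g b \<otimes>\<^bsub>M\<^esub> z = \<one>\<^bsub>M\<^esub>"
      using \<open>h \<in> N\<close> unfolding N_def by blast
    note carr = mem_carrier(1)[OF h(2)] mem_carrier(2)[OF h(3)] mem_carrier(3,4)[OF h(4)] pqe
    let ?c = "commutator M (g q) (f a)" and ?d = "commutator M (g b) (f p)"
    let ?z = "z \<otimes>\<^bsub>M\<^esub> ?c \<otimes>\<^bsub>M\<^esub> inv\<^bsub>M\<^esub> ?d"
    let ?a = "p \<otimes>\<^bsub>A\<^esub> a \<otimes>\<^bsub>A\<^esub> inv\<^bsub>A\<^esub> p" and ?b = "q \<otimes>\<^bsub>B\<^esub> b \<otimes>\<^bsub>B\<^esub> inv\<^bsub>B\<^esub> q"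
    have c: "?c \<in> Z" "\<kappa> a q = \<iota> ?c" and d: "?d \<in> Z" "\<kappa> p b = \<iota> ?d"
      using commutator_left commutator_right h carr by auto
    have Zs: "inv\<^bsub>M\<^esub> ?d \<in> Z" "z \<otimes>\<^bsub>M\<^esub> ?c \<in> Z" "?z \<in> Z"
      using c d h Z_subgroup by (auto simp: subgroup.m_closed subgroup.m_inv_closed)
    have \<kappa>_conj: "\<kappa> p ?b = \<kappa> p b"
      using carr by (simp add: mult_right inv_right K.m_ac)
    have N: "(?a, ?b, \<iota> ?z) \<in> N"
    proof (rule NI)
      show "?a \<in> NA" "?b \<in> NB" "?z \<in> Z"
        using h carr Zs NA NB by (auto simp: normal.inv_op_closed2)
      show "f ?a \<otimes>\<^bsub>M\<^esub> g ?b \<otimes>\<^bsub>M\<^esub> ?z = \<one>\<^bsub>M\<^esub>"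
        using M.conjugates_mult_eq_one[of "f a" "g b" "f p" "g q" z] carr h Z_center by auto
    qed
    \<comment> \<open>Comparing \<open>x h\<close> with the conjugate times \<open>x\<close> avoids
      computing the inverse of \<open>x\<close> in the twisted product.\<close>
    have "x \<otimes>\<^bsub>P\<^esub> h = (?a, ?b, \<iota> ?z) \<otimes>\<^bsub>P\<^esub> x"
    proof -
      have "?a \<otimes>\<^bsub>A\<^esub> p = p \<otimes>\<^bsub>A\<^esub> a" "?b \<otimes>\<^bsub>B\<^esub> q = q \<otimes>\<^bsub>B\<^esub> b"
        using carr by (simp_all add: A.m_assoc B.m_assoc)
      moreover have "e \<otimes>\<^bsub>K\<^esub> \<iota> z \<otimes>\<^bsub>K\<^esub> \<kappa> a q = \<iota> ?z \<otimes>\<^bsub>K\<^esub> e \<otimes>\<^bsub>K\<^esub> \<kappa> p ?b"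
      proof -
        have "inv\<^bsub>K\<^esub> \<kappa> p b \<otimes>\<^bsub>K\<^esub> (e \<otimes>\<^bsub>K\<^esub> \<kappa> p b) = e"
          using carr K.m_assoc[of "inv\<^bsub>K\<^esub> \<kappa> p b" "\<kappa> p b" e] K.m_comm[of e "\<kappa> p b"] by simp
        moreover have "\<iota> ?z = \<iota> z \<otimes>\<^bsub>K\<^esub> \<kappa> a q \<otimes>\<^bsub>K\<^esub> inv\<^bsub>K\<^esub> \<kappa> p b"
          using c d h Zs by (simp add: \<iota>_mult \<iota>_inv)
        ultimately show ?thesis
          using carr by (simp add: \<kappa>_conj K.m_assoc K.m_comm[of e])
      qed
      ultimately show ?thesis
        unfolding x_eq h(1) by simp
    qed
    then have "x \<otimes>\<^bsub>P\<^esub> h \<otimes>\<^bsub>P\<^esub> inv\<^bsub>P\<^esub> x = (?a, ?b, \<iota> ?z)"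
      using x N subgroup.mem_carrier[OF subgroup_N] by (simp add: P.m_assoc P.r_inv del: twisted_product_simps)
    then show ?thesis using N by simp
  qed
  then show ?thesis
    by (simp add: P.normal_inv_iff subgroup_N del: twisted_product_simps)
qed

end

section \<open>Embedding the amalgam in the quotient of the twisted product\<close>

context gluing
begin

text \<open>In the quotient by \<open>N\<close> the factors stay embedded: if
  \<open>(a, 1, 1)\<close> lies in \<open>N\<close>, its \<open>z\<close> is trivial by injectivity
  of \<open>\<iota>\<close>, so \<open>f a\<close> and hence \<open>a\<close> are trivial, and
  likewise for B.\<close>

lemma weakly_embeddable_gluing:
  assumes P: "in_variety m n P"
    and \<alpha>: "\<And>d. d \<in> carrier D \<Longrightarrow> \<alpha> d \<in> NA" and \<beta>: "\<And>d. d \<in> carrier D \<Longrightarrow> \<beta> d \<in> NB"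
    and agree: "\<And>d. d \<in> carrier D \<Longrightarrow> f (\<alpha> d) = g (\<beta> d)"
  shows "weakly_embeddable (in_variety m n) A B D \<alpha> \<beta>"
proof -
  interpret P: group P by (rule group_twisted_product)
  interpret N: normal N P by (rule normal_N)
  interpret Q: group "P Mod N" by (rule N.factorgroup_is_group)
  define \<pi> where "\<pi> x = N #>\<^bsub>P\<^esub> x" for x
  have \<pi>_hom: "\<pi> \<in> hom P (P Mod N)"
    using N.r_coset_hom_Mod by (simp add: \<pi>_def[abs_def])
  interpret \<pi>: group_hom P "P Mod N" \<pi>
    using \<pi>_hom by unfold_locales
  have \<pi>_one: "\<pi> x = \<one>\<^bsub>P Mod N\<^esub> \<longleftrightarrow> x \<in> N" if "x \<in> carrier P" for x
    using that unfolding \<pi>_def by (metis P.coset_join2 P.rcos_self N.subgroup_axioms one_FactGroup)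
  have "\<pi> \<in> epi P (P Mod N)"
    using \<pi>_hom by (auto simp: epi_def carrier_FactGroup \<pi>_def[abs_def])
  then have var: "in_variety m n (P Mod N)"
    by (rule in_variety_epi[OF P Q.is_group])
  define F where "F a = \<pi> (a, \<one>\<^bsub>B\<^esub>, \<one>\<^bsub>K\<^esub>)" for a
  define F' where "F' b = \<pi> (\<one>\<^bsub>A\<^esub>, b, \<one>\<^bsub>K\<^esub>)" for b
  have F_hom: "F \<in> hom A (P Mod N)"
  proof (rule homI)
    show "F a \<in> carrier (P Mod N)" if "a \<in> carrier A" for a
      unfolding F_def using that by (intro \<pi>.hom_closed) simp
    show "F (a \<otimes>\<^bsub>A\<^esub> a') = F a \<otimes>\<^bsub>P Mod N\<^esub> F a'" if "a \<in> carrier A" "a' \<in> carrier A" for a a'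
      unfolding F_def using that by (subst \<pi>.hom_mult[symmetric]) simp_all
  qed
  have F'_hom: "F' \<in> hom B (P Mod N)"
  proof (rule homI)
    show "F' b \<in> carrier (P Mod N)" if "b \<in> carrier B" for b
      unfolding F'_def using that by (intro \<pi>.hom_closed) simp
    show "F' (b \<otimes>\<^bsub>B\<^esub> b') = F' b \<otimes>\<^bsub>P Mod N\<^esub> F' b'" if "b \<in> carrier B" "b' \<in> carrier B" for b b'
      unfolding F'_def using that by (subst \<pi>.hom_mult[symmetric]) simp_all
  qed
  interpret F: group_hom A "P Mod N" F using F_hom by unfold_locales
  interpret F': group_hom B "P Mod N" F' using F'_hom by unfold_locales
  have "a = \<one>\<^bsub>A\<^esub>" if a: "a \<in> carrier A" "F a = \<one>\<^bsub>P Mod N\<^esub>" for a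
  proof -
    have "(a, \<one>\<^bsub>B\<^esub>, \<one>\<^bsub>K\<^esub>) \<in> N"
      using a \<pi>_one[of "(a, \<one>\<^bsub>B\<^esub>, \<one>\<^bsub>K\<^esub>)"] by (simp add: F_def)
    then obtain z where z: "z \<in> Z" "\<iota> z = \<one>\<^bsub>K\<^esub>" "f a \<otimes>\<^bsub>M\<^esub> g \<one>\<^bsub>B\<^esub> \<otimes>\<^bsub>M\<^esub> z = \<one>\<^bsub>M\<^esub>"
      unfolding N_def by auto
    have "z = \<one>\<^bsub>M\<^esub>"
      using z by (intro \<iota>_eq_one)
    then have "f a = f \<one>\<^bsub>A\<^esub>"
      using z(3) a by simp
    then show ?thesis
      using inj_onD[OF inj_f] a by blast
  qed
  then have F: "F \<in> mon A (P Mod N)"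
    using F_hom F.inj_iff_trivial_ker by (auto simp: mon_def kernel_def)
  have "b = \<one>\<^bsub>B\<^esub>" if b: "b \<in> carrier B" "F' b = \<one>\<^bsub>P Mod N\<^esub>" for b
  proof -
    have "(\<one>\<^bsub>A\<^esub>, b, \<one>\<^bsub>K\<^esub>) \<in> N"
      using b \<pi>_one[of "(\<one>\<^bsub>A\<^esub>, b, \<one>\<^bsub>K\<^esub>)"] by (simp add: F'_def)
    then obtain z where z: "z \<in> Z" "\<iota> z = \<one>\<^bsub>K\<^esub>" "f \<one>\<^bsub>A\<^esub> \<otimes>\<^bsub>M\<^esub> g b \<otimes>\<^bsub>M\<^esub> z = \<one>\<^bsub>M\<^esub>"
      unfolding N_def by auto
    have "z = \<one>\<^bsub>M\<^esub>"
      using z by (intro \<iota>_eq_one)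
    then have "g b = g \<one>\<^bsub>B\<^esub>"
      using z(3) b by simp
    then show ?thesis
      using inj_onD[OF inj_g] b by blast
  qed
  then have F': "F' \<in> mon B (P Mod N)"
    using F'_hom F'.inj_iff_trivial_ker by (auto simp: mon_def kernel_def)
  have FF': "F (\<alpha> d) = F' (\<beta> d)" if d: "d \<in> carrier D" for d
  proof -
    have carr: "\<alpha> d \<in> carrier A" "\<beta> d \<in> carrier B"
      using \<alpha>[OF d] \<beta>[OF d] mem_carrier by auto
    \<comment> \<open>This element identifies the two copies of \<open>d\<close>. It is the product
      of its A-part and its B-part in this order, which carries only the trivial twist of the
      neutral elements.\<close>
    have "(\<alpha> d, inv\<^bsub>B\<^esub> \<beta> d, \<iota> \<one>\<^bsub>M\<^esub>) \<in> N"
      using \<alpha>[OF d] subgroup.m_inv_closed[OF NB_subgroup \<beta>[OF d]] subgroup.one_closed[OF Z_subgroup]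
        agree[OF d] carr by (intro NI) simp_all
    then have "\<one>\<^bsub>P Mod N\<^esub> = \<pi> (\<alpha> d, inv\<^bsub>B\<^esub> \<beta> d, \<one>\<^bsub>K\<^esub>)"
      using \<pi>_one[of "(\<alpha> d, inv\<^bsub>B\<^esub> \<beta> d, \<one>\<^bsub>K\<^esub>)"] carr by (simp add: \<iota>_one)
    also have "\<dots> = F (\<alpha> d) \<otimes>\<^bsub>P Mod N\<^esub> F' (inv\<^bsub>B\<^esub> \<beta> d)"
      unfolding F_def F'_def using carr by (subst \<pi>.hom_mult[symmetric]) simp_all
    finally have "F (\<alpha> d) \<otimes>\<^bsub>P Mod N\<^esub> inv\<^bsub>P Mod N\<^esub> F' (\<beta> d) = \<one>\<^bsub>P Mod N\<^esub>"
      using carr F'.hom_inv by metis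
    then show ?thesis
      using carr F.hom_closed F'.hom_closed by (metis Q.inv_closed Q.inv_equality Q.inv_inv)
  qed
  show ?thesis
    using \<alpha> \<beta> mem_carrier by (intro weakly_embeddableI[OF A.is_group B.is_group var F F' _ _ FF']) auto
qed

end

section \<open>Pairings modulo derived subgroups\<close>

lemma (in pairing) derived_left:
  assumes "c \<in> derived G (carrier G)" "y \<in> carrier H"
  shows "p c y = \<one>\<^bsub>K\<^esub>"
proof -
  interpret h: group_hom G K "\<lambda>x. p x y" by (rule group_hom_left[OF assms(2)])
  have "derived G (carrier G) \<subseteq> kernel G K (\<lambda>x. p x y)"
    unfolding derived_def derived_set_eq_commutators[OF G.is_group]
    using assms(2) by (intro G.generate_subgroup_incl h.subgroup_kernel) (auto simp: kernel_def commutator_eq_one_left)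
  then show ?thesis
    using assms(1) by (auto simp: kernel_def)
qed

lemma (in pairing) derived_right:
  assumes "x \<in> carrier G" "c \<in> derived H (carrier H)"
  shows "p x c = \<one>\<^bsub>K\<^esub>"
proof -
  interpret h: group_hom H K "p x" by (rule group_hom_right[OF assms(1)])
  have "derived H (carrier H) \<subseteq> kernel H K (p x)"
    unfolding derived_def derived_set_eq_commutators[OF H.is_group]
    using assms(1) by (intro H.generate_subgroup_incl h.subgroup_kernel) (auto simp: kernel_def commutator_eq_one_right)
  then show ?thesis
    using assms(2) by (auto simp: kernel_def)
qed

text \<open>The value on two cosets is taken at chosen representatives. The choice is immaterial
  because the pairing is trivial on both derived subgroups.\<close>

lemma (in pairing) factor_abelianization:
  obtains q where "pairing (G Mod derived G (carrier G)) (H Mod derived H (carrier H)) K q"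
    and "\<And>x y. \<lbrakk>x \<in> carrier G; y \<in> carrier H\<rbrakk> \<Longrightarrow>
      q (derived G (carrier G) #>\<^bsub>G\<^esub> x) (derived H (carrier H) #>\<^bsub>H\<^esub> y) = p x y"
proof -
  let ?U = "G Mod derived G (carrier G)" and ?V = "H Mod derived H (carrier H)"
  define \<pi> where "\<pi> x = derived G (carrier G) #>\<^bsub>G\<^esub> x" for x
  define \<rho> where "\<rho> y = derived H (carrier H) #>\<^bsub>H\<^esub> y" for y
  interpret NG: normal "derived G (carrier G)" G by (rule G.derived_self_is_normal)
  interpret NH: normal "derived H (carrier H)" H by (rule H.derived_self_is_normal)
  interpret U: group ?U by (rule NG.factorgroup_is_group)
  interpret V: group ?V by (rule NH.factorgroup_is_group)
  have \<pi>_left: "p x y = p x' y" if "x \<in> carrier G" "x' \<in> carrier G" "\<pi> x = \<pi> x'" "y \<in> carrier H" for x x' y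
  proof -
    have "x \<in> derived G (carrier G) #>\<^bsub>G\<^esub> x'"
      using that G.rcos_self[OF _ NG.subgroup_axioms] by (metis \<pi>_def)
    then obtain c where c: "c \<in> derived G (carrier G)" "x = c \<otimes>\<^bsub>G\<^esub> x'"
      by (auto simp: r_coset_def)
    then show ?thesis
      using that NG.mem_carrier by (simp add: mult_left derived_left)
  qed
  have \<rho>_right: "p x y = p x y'" if "x \<in> carrier G" "y \<in> carrier H" "y' \<in> carrier H" "\<rho> y = \<rho> y'" for x y y'
  proof -
    have "y \<in> derived H (carrier H) #>\<^bsub>H\<^esub> y'"
      using that H.rcos_self[OF _ NH.subgroup_axioms] by (metis \<rho>_def)
    then obtain c where c: "c \<in> derived H (carrier H)" "y = c \<otimes>\<^bsub>H\<^esub> y'"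
      by (auto simp: r_coset_def)
    then show ?thesis
      using that NH.mem_carrier by (simp add: mult_right derived_right)
  qed
  define rU where "rU X = (SOME x. x \<in> carrier G \<and> \<pi> x = X)" for X
  define rV where "rV Y = (SOME y. y \<in> carrier H \<and> \<rho> y = Y)" for Y
  have rU: "rU (\<pi> x) \<in> carrier G \<and> \<pi> (rU (\<pi> x)) = \<pi> x" if "x \<in> carrier G" for x
    unfolding rU_def by (rule someI[of _ x]) (use that in simp)
  have rV: "rV (\<rho> y) \<in> carrier H \<and> \<rho> (rV (\<rho> y)) = \<rho> y" if "y \<in> carrier H" for y
    unfolding rV_def by (rule someI[of _ y]) (use that in simp)
  define q where "q X Y = p (rU X) (rV Y)" for X Y
  have q: "q (\<pi> x) (\<rho> y) = p x y" if "x \<in> carrier G" "y \<in> carrier H" for x y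
    unfolding q_def using that rU rV \<pi>_left[of "rU (\<pi> x)" x "rV (\<rho> y)"] \<rho>_right[of x "rV (\<rho> y)" y] by simp
  have carU: "carrier ?U = \<pi> ` carrier G" and carV: "carrier ?V = \<rho> ` carrier H"
    by (auto simp: carrier_FactGroup \<pi>_def \<rho>_def)
  have \<pi>_mult: "\<pi> x \<otimes>\<^bsub>?U\<^esub> \<pi> x' = \<pi> (x \<otimes>\<^bsub>G\<^esub> x')" if "x \<in> carrier G" "x' \<in> carrier G" for x x'
    using that NG.rcos_sum by (simp add: \<pi>_def)
  have \<rho>_mult: "\<rho> x \<otimes>\<^bsub>?V\<^esub> \<rho> x' = \<rho> (x \<otimes>\<^bsub>H\<^esub> x')" if "x \<in> carrier H" "x' \<in> carrier H" for x x'
    using that NH.rcos_sum by (simp add: \<rho>_def)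
  have "pairing ?U ?V K q"
  proof unfold_locales
    show "q X Y \<in> carrier K" if "X \<in> carrier ?U" "Y \<in> carrier ?V" for X Y
      using that by (auto simp: carU carV q)
    show "q (X \<otimes>\<^bsub>?U\<^esub> X') Y = q X Y \<otimes>\<^bsub>K\<^esub> q X' Y"
      if XY: "X \<in> carrier ?U" "X' \<in> carrier ?U" "Y \<in> carrier ?V" for X X' Y
    proof -
      obtain x x' y where "X = \<pi> x" "X' = \<pi> x'" "Y = \<rho> y" "x \<in> carrier G" "x' \<in> carrier G" "y \<in> carrier H"
        using XY unfolding carU carV by blast
      then show ?thesis by (simp only: \<pi>_mult q G.m_closed mult_left)
    qed
    show "q X (Y \<otimes>\<^bsub>?V\<^esub> Y') = q X Y \<otimes>\<^bsub>K\<^esub> q X Y'"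
      if XY: "X \<in> carrier ?U" "Y \<in> carrier ?V" "Y' \<in> carrier ?V" for X Y Y'
    proof -
      obtain x y y' where "X = \<pi> x" "Y = \<rho> y" "Y' = \<rho> y'" "x \<in> carrier G" "y \<in> carrier H" "y' \<in> carrier H"
        using XY unfolding carU carV by blast
      then show ?thesis by (simp only: \<rho>_mult q H.m_closed mult_right)
    qed
  qed
  then show thesis
    using that[of q] q by (simp add: \<pi>_def \<rho>_def)
qed

lemma (in pairing) comp_hom:
  assumes "group_hom G' G \<phi>" "group_hom H' H \<psi>"
  shows "pairing G' H' K (\<lambda>x y. p (\<phi> x) (\<psi> y))"
proof -
  interpret \<phi>: group_hom G' G \<phi> by fact
  interpret \<psi>: group_hom H' H \<psi> by fact
  show ?thesis
    by unfold_locales (simp_all add: mult_left mult_right)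
qed

section \<open>Amalgams\<close>

lemma (in group_hom) subgroup_vimage:
  assumes "subgroup S H"
  shows "subgroup {x \<in> carrier G. h x \<in> S} G"
  by (rule G.subgroupI)
     (use subgroup.one_closed[OF assms] subgroup.m_closed[OF assms] subgroup.m_inv_closed[OF assms] in \<open>auto intro: exI[of _ "\<one>\<^bsub>G\<^esub>"]\<close>)

lemma (in group_hom) normal_vimage_comm_group:
  assumes "comm_group H" and S: "subgroup S H"
  shows "{x \<in> carrier G. h x \<in> S} \<lhd> G"
proof -
  interpret H: comm_group H by fact
  have "h (x \<otimes> y \<otimes> inv x) = h y" if "x \<in> carrier G" "y \<in> carrier G" for x y
    using that by (simp add: H.m_comm[of "h x" "h y"] H.m_assoc H.r_inv)
  then show ?thesis
    using subgroup_vimage[OF S] by (auto simp: G.normal_inv_iff)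
qed

section \<open>Necessity of the centrality conditions\<close>

text \<open>The preimage of the center of \<open>M\<close> is a subgroup containing all n-th powers
  and all commutators. Centrality holds in all of \<open>M\<close>, so it also concerns the image of
  the other factor.\<close>

lemma hom_power_derived_in_center:
  assumes M: "in_variety m n M" and A: "group A" and f: "f \<in> hom A M"
    and a: "a \<in> power_subgroup A n <#>\<^bsub>A\<^esub> derived A (carrier A)"
  shows "f a \<in> center M"
proof -
  interpret M: class_two_group M by (rule in_variety_imp_class_two[OF M])
  interpret A: group A by fact
  interpret f: group_hom A M f using f by unfold_locales
  interpret C: pairing M M "M\<lparr>carrier := center M\<rparr>" "commutator M" by (rule M.pairing_commutator)
  define S where "S = {a \<in> carrier A. f a \<in> center M}"
  have S: "subgroup S A"
    unfolding S_def by (rule f.subgroup_vimage[OF M.subgroup_center])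
  have "x [^]\<^bsub>A\<^esub> n \<in> S" if x: "x \<in> carrier A" for x
  proof -
    have "f x [^]\<^bsub>M\<^esub> n \<otimes>\<^bsub>M\<^esub> y = y \<otimes>\<^bsub>M\<^esub> f x [^]\<^bsub>M\<^esub> n" if y: "y \<in> carrier M" for y
    proof -
      have "commutator M (f x [^]\<^bsub>M\<^esub> n) y = commutator M (f x) y [^]\<^bsub>M\<^esub> n"
        using C.nat_pow_left[of "f x" y n] x y M.nat_pow_consistent by simp
      also have "\<dots> = \<one>\<^bsub>M\<^esub>"
        using M x y by (simp add: in_variety_def)
      finally show ?thesis
        using M.mult_commutator[of "f x [^]\<^bsub>M\<^esub> n" y] x y by simp
    qed
    then show ?thesis
      using x by (simp add: S_def center_def f.hom_nat_pow)
  qed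
  then have "generate A {x [^]\<^bsub>A\<^esub> n | x. x \<in> carrier A} \<subseteq> S"
    using S by (intro A.generate_subgroup_incl) auto
  then have "power_subgroup A n \<subseteq> S"
    using subgroup.one_closed[OF S] by (simp add: power_subgroup_def)
  moreover have "derived A (carrier A) \<subseteq> S"
    unfolding derived_def derived_set_eq_commutators[OF A]
    using S by (intro A.generate_subgroup_incl) (auto simp: S_def f.hom_commutator M.commutator_in_center)
  ultimately have "a \<in> S"
    using a subgroup.m_closed[OF S] by (auto simp: set_mult_def)
  then show ?thesis by (simp add: S_def)
qed

text \<open>Centrality in \<open>M\<close> is pulled back along the injection \<open>g\<close>.
  Exchanging the factors gives the other condition.\<close>

lemma weakly_embeddable_imp_central:
  assumes M: "in_variety m n M" and A: "group A" and B: "group B"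
    and f: "f \<in> hom A M" and g: "g \<in> mon B M" and b: "b \<in> carrier B" and eq: "f a = g b"
    and a: "a \<in> power_subgroup A n <#>\<^bsub>A\<^esub> derived A (carrier A)"
  shows "b \<in> center B"
proof -
  interpret B: group B by fact
  have gh: "g \<in> hom B M" and inj: "inj_on g (carrier B)" using g by (auto simp: mon_def)
  have cen: "g b \<in> center M"
    using hom_power_derived_in_center[OF M A f a] eq by simp
  have "b \<otimes>\<^bsub>B\<^esub> y = y \<otimes>\<^bsub>B\<^esub> b" if y: "y \<in> carrier B" for y
  proof (rule inj_onD[OF inj])
    show "g (b \<otimes>\<^bsub>B\<^esub> y) = g (y \<otimes>\<^bsub>B\<^esub> b)"
      using cen b y hom_in_carrier[OF gh y] by (simp add: hom_mult[OF gh] center_def)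
  qed (use b y in auto)
  then show ?thesis using b by (simp add: center_def)
qed

section \<open>Sufficiency of the conditions for positive n\<close>

lemma weakly_embeddable_in_variety:
  fixes A :: "('a, 'x) monoid_scheme" and B :: "('b, 'y) monoid_scheme" and M :: "('c, 'w) monoid_scheme"
  assumes n: "n > 0" and mn: "n dvd m div gcd 2 m"
    and A: "in_variety m n A" and B: "in_variety m n B" and D: "group D"
    and \<alpha>: "\<alpha> \<in> hom D A" and \<beta>: "\<beta> \<in> hom D B"
    and M: "in_N2 M" and f: "f \<in> mon A M" and g: "g \<in> mon B M"
    and agree: "\<And>d. d \<in> carrier D \<Longrightarrow> f (\<alpha> d) = g (\<beta> d)"
    and cenA: "\<And>d. \<lbrakk>d \<in> carrier D; \<alpha> d \<in> power_subgroup A n <#>\<^bsub>A\<^esub> derived A (carrier A)\<rbrakk> \<Longrightarrow> \<beta> d \<in> center B"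
    and cenB: "\<And>d. \<lbrakk>d \<in> carrier D; \<beta> d \<in> power_subgroup B n <#>\<^bsub>B\<^esub> derived B (carrier B)\<rbrakk> \<Longrightarrow> \<alpha> d \<in> center A"
  shows "weakly_embeddable (in_variety m n) A B D \<alpha> \<beta>"
proof -
  interpret A: class_two_group A by (rule in_variety_imp_class_two[OF A])
  interpret B: class_two_group B by (rule in_variety_imp_class_two[OF B])
  interpret M: class_two_group M using M in_variety_imp_class_two by (auto simp: in_N2_def)
  interpret D: group D by fact
  interpret f: group_hom A M f using f by unfold_locales (simp add: mon_def)
  interpret g: group_hom B M g using g by unfold_locales (simp add: mon_def)
  interpret \<alpha>: group_hom D A \<alpha> using \<alpha> by unfold_locales
  interpret \<beta>: group_hom D B \<beta> using \<beta> by unfold_locales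
  let ?Z = "M\<lparr>carrier := center M\<rparr>" and ?c = "commutator M"
  interpret Zc: comm_group ?Z by (rule M.comm_group_center)
  interpret C: pairing M M ?Z ?c by (rule M.pairing_commutator)
  \<comment> \<open>The pairing \<open>br\<close> is the one to be divided by n. The pairing
    \<open>rb\<close>, with inverse values, enters the twist, since \<open>\<kappa> a b\<close> has
    to be the commutator of \<open>b\<close> and \<open>a\<close>.\<close>
  interpret br: pairing A B ?Z "\<lambda>a b. ?c (f a) (g b)"
    by (rule C.comp_hom[OF f.group_hom_axioms g.group_hom_axioms])
  interpret rb: pairing A B ?Z "\<lambda>a b. ?c (g b) (f a)"
    by unfold_locales (simp_all add: M.commutator_in_center M.commutator_mult_left M.commutator_mult_right)

  let ?A' = "derived A (carrier A)" and ?B' = "derived B (carrier B)"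
  let ?U = "A Mod ?A'" and ?V = "B Mod ?B'"
  interpret A': normal ?A' A by (rule A.derived_self_is_normal)
  interpret B': normal ?B' B by (rule B.derived_self_is_normal)
  interpret U: comm_group ?U by (rule A.derived_quot_is_comm_group)
  interpret V: comm_group ?V by (rule B.derived_quot_is_comm_group)
  define \<pi> where "\<pi> a = ?A' #>\<^bsub>A\<^esub> a" for a
  define \<rho> where "\<rho> b = ?B' #>\<^bsub>B\<^esub> b" for b
  interpret \<pi>: group_hom A ?U \<pi>
    using A'.r_coset_hom_Mod by unfold_locales (simp add: \<pi>_def[abs_def])
  interpret \<rho>: group_hom B ?V \<rho>
    using B'.r_coset_hom_Mod by unfold_locales (simp add: \<rho>_def[abs_def])
  have \<pi>_surj: "\<exists>a\<in>carrier A. x = \<pi> a" if "x \<in> carrier ?U" for x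
    using that by (auto simp: carrier_FactGroup \<pi>_def)
  have \<rho>_surj: "\<exists>b\<in>carrier B. y = \<rho> b" if "y \<in> carrier ?V" for y
    using that by (auto simp: carrier_FactGroup \<rho>_def)
  obtain q where q: "pairing ?U ?V ?Z q"
    and q_eq: "\<And>a b. \<lbrakk>a \<in> carrier A; b \<in> carrier B\<rbrakk> \<Longrightarrow> q (\<pi> a) (\<rho> b) = ?c (f a) (g b)"
    using br.factor_abelianization unfolding \<pi>_def \<rho>_def by blast

  have A'_central: "c \<otimes>\<^bsub>A\<^esub> x = x \<otimes>\<^bsub>A\<^esub> c" if "c \<in> ?A'" "x \<in> carrier A" for c x
    using that A.in_N2 A.center_commute by (auto simp: in_N2_iff)
  have B'_central: "c \<otimes>\<^bsub>B\<^esub> x = x \<otimes>\<^bsub>B\<^esub> c" if "c \<in> ?B'" "x \<in> carrier B" for c x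
    using that B.in_N2 B.center_commute by (auto simp: in_N2_iff)
  \<comment> \<open>This is DA'/A', and \<open>DV\<close> below is DB'/B'.\<close>
  define DU where "DU = (\<pi> \<circ> \<alpha>) ` carrier D"
  define DV where "DV = (\<rho> \<circ> \<beta>) ` carrier D"
  have DU: "subgroup DU ?U"
    unfolding DU_def image_comp[symmetric]
    by (rule \<pi>.subgroup_img_is_subgroup[OF \<alpha>.img_is_subgroup])
  have DV: "subgroup DV ?V"
    unfolding DV_def image_comp[symmetric]
    by (rule \<rho>.subgroup_img_is_subgroup[OF \<beta>.img_is_subgroup])
  \<comment> \<open>Lifted to A, the hypothesis puts \<open>\<alpha> d\<close> into A^nA'. By
    \<open>cenA\<close> the element \<open>\<beta> d\<close> is then central in B, so its image in
    \<open>M\<close>, which is also that of \<open>\<alpha> d\<close>, commutes with the image of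
    B.\<close>
  have q_power_left: "q (x [^]\<^bsub>?U\<^esub> n) y = \<one>\<^bsub>?Z\<^esub>"
    if x: "x \<in> carrier ?U" "x [^]\<^bsub>?U\<^esub> n \<in> DU" and y: "y \<in> carrier ?V" for x y
  proof -
    obtain a where a: "a \<in> carrier A" "x = \<pi> a" using \<pi>_surj x by blast
    obtain b where b: "b \<in> carrier B" "y = \<rho> b" using \<rho>_surj y by blast
    obtain d where d: "d \<in> carrier D" "x [^]\<^bsub>?U\<^esub> n = \<pi> (\<alpha> d)" using x by (auto simp: DU_def)
    have "\<pi> (\<alpha> d) = \<pi> (a [^]\<^bsub>A\<^esub> n)"
      using d a by (simp add: \<pi>.hom_nat_pow)
    then have "\<alpha> d \<in> ?A' #>\<^bsub>A\<^esub> a [^]\<^bsub>A\<^esub> n"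
      using A.rcos_self[OF _ A'.subgroup_axioms, of "\<alpha> d"] d by (simp add: \<pi>_def)
    then obtain c where c: "c \<in> ?A'" "\<alpha> d = c \<otimes>\<^bsub>A\<^esub> a [^]\<^bsub>A\<^esub> n"
      by (auto simp: r_coset_def)
    then have "\<alpha> d = a [^]\<^bsub>A\<^esub> n \<otimes>\<^bsub>A\<^esub> c"
      using a A'_central[of c "a [^]\<^bsub>A\<^esub> n"] by simp
    moreover have "a [^]\<^bsub>A\<^esub> n \<in> power_subgroup A n"
      using a n by (auto simp: power_subgroup_def intro!: generate.incl)
    ultimately have "\<beta> d \<in> center B"
      using c d by (intro cenA) (auto simp: set_mult_def)
    then have "commutator B (\<beta> d) b = \<one>\<^bsub>B\<^esub>"
      using b d B.center_commute[of "\<beta> d" b] by (intro B.commutator_eqI) simp_all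
    then have "?c (g (\<beta> d)) (g b) = \<one>\<^bsub>M\<^esub>"
      using b d g.hom_commutator[of "\<beta> d" b] by simp
    then show ?thesis
      using b d agree[OF d(1)] by (simp add: q_eq)
  qed
  have q_power_right: "q x (y [^]\<^bsub>?V\<^esub> n) = \<one>\<^bsub>?Z\<^esub>"
    if y: "y \<in> carrier ?V" "y [^]\<^bsub>?V\<^esub> n \<in> DV" and x: "x \<in> carrier ?U" for x y
  proof -
    obtain a where a: "a \<in> carrier A" "x = \<pi> a" using \<pi>_surj x by blast
    obtain b where b: "b \<in> carrier B" "y = \<rho> b" using \<rho>_surj y by blast
    obtain d where d: "d \<in> carrier D" "y [^]\<^bsub>?V\<^esub> n = \<rho> (\<beta> d)" using y by (auto simp: DV_def)
    have "\<rho> (\<beta> d) = \<rho> (b [^]\<^bsub>B\<^esub> n)"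
      using d b by (simp add: \<rho>.hom_nat_pow)
    then have "\<beta> d \<in> ?B' #>\<^bsub>B\<^esub> b [^]\<^bsub>B\<^esub> n"
      using B.rcos_self[OF _ B'.subgroup_axioms, of "\<beta> d"] d by (simp add: \<rho>_def)
    then obtain c where c: "c \<in> ?B'" "\<beta> d = c \<otimes>\<^bsub>B\<^esub> b [^]\<^bsub>B\<^esub> n"
      by (auto simp: r_coset_def)
    then have "\<beta> d = b [^]\<^bsub>B\<^esub> n \<otimes>\<^bsub>B\<^esub> c"
      using b B'_central[of c "b [^]\<^bsub>B\<^esub> n"] by simp
    moreover have "b [^]\<^bsub>B\<^esub> n \<in> power_subgroup B n"
      using b n by (auto simp: power_subgroup_def intro!: generate.incl)
    ultimately have "\<alpha> d \<in> center A"
      using c d by (intro cenB) (auto simp: set_mult_def)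
    then have "commutator A a (\<alpha> d) = \<one>\<^bsub>A\<^esub>"
      using a d A.center_commute[of "\<alpha> d" a] by (intro A.commutator_eqI) simp_all
    then have "?c (f a) (f (\<alpha> d)) = \<one>\<^bsub>M\<^esub>"
      using a d f.hom_commutator[of a "\<alpha> d"] by simp
    then show ?thesis
      using a d agree[OF d(1)] by (simp add: q_eq)
  qed
  interpret q: central_pairing ?U ?V ?Z q DU DV n
    using q DU DV q_power_left q_power_right
    by (simp add: central_pairing_def central_pairing_axioms_def U.comm_group_axioms V.comm_group_axioms)
  obtain E :: "(('a set \<times> 'b set \<Rightarrow>\<^sub>0 int) \<times> 'c) set monoid" and \<iota> \<mu>
    where \<mu>: "pairing ?U ?V E \<mu>" and \<iota>: "\<iota> \<in> mon ?Z E"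
      and \<mu>_pow: "\<And>x y. \<lbrakk>x \<in> carrier ?U; y \<in> carrier ?V\<rbrakk> \<Longrightarrow> \<mu> x y [^]\<^bsub>E\<^esub> n = \<iota> (q x y [^]\<^bsub>?Z\<^esub> n)"
      and \<mu>_left: "\<And>x y. \<lbrakk>x \<in> DU; y \<in> carrier ?V\<rbrakk> \<Longrightarrow> \<mu> x y = \<one>\<^bsub>E\<^esub>"
      and \<mu>_right: "\<And>x y. \<lbrakk>x \<in> carrier ?U; y \<in> DV\<rbrakk> \<Longrightarrow> \<mu> x y = \<one>\<^bsub>E\<^esub>"
    by (rule q.divide_pairing[OF n]) (rule that)
  interpret E: comm_group E
    using \<mu> by (simp add: pairing_def)
  interpret \<mu>: pairing A B E "\<lambda>a b. \<mu> (\<pi> a) (\<rho> b)"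
    by (rule pairing.comp_hom[OF \<mu> \<pi>.group_hom_axioms \<rho>.group_hom_axioms])
  interpret \<iota>: group_hom ?Z E \<iota>
    using \<iota> by unfold_locales (simp add: mon_def)

  \<comment> \<open>The n-torsion of E, which is to contain all mixed commutators of the new
    group.\<close>
  define S where "S = {e \<in> carrier E. e [^]\<^bsub>E\<^esub> n = \<one>\<^bsub>E\<^esub>}"
  have S: "subgroup S E"
    by (rule E.subgroupI) (auto simp: S_def E.nat_pow_distrib E.nat_pow_inv intro: exI[of _ "\<one>\<^bsub>E\<^esub>"])
  let ?K = "E\<lparr>carrier := S\<rparr>"
  interpret K: comm_group ?K
    by (rule group.group_comm_groupI[OF E.subgroup_imp_group[OF S]])
       (use subgroup.mem_carrier[OF S] in \<open>simp add: E.m_comm\<close>)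
  define \<kappa> where "\<kappa> a b = \<iota> (?c (g b) (f a)) \<otimes>\<^bsub>E\<^esub> \<mu> (\<pi> a) (\<rho> b)" for a b
  have \<iota>_closed: "\<iota> (?c (g b) (f a)) \<in> carrier E" if "a \<in> carrier A" "b \<in> carrier B" for a b
    using that by (intro \<iota>.hom_closed) (simp add: M.commutator_in_center)
  \<comment> \<open>The n-th power of the first factor is the image of [b,a]^n, that of the second
    the image of [a,b]^n by the choice of \<open>\<mu>\<close>; they cancel.\<close>
  have \<kappa>_S: "\<kappa> a b \<in> S" if ab: "a \<in> carrier A" "b \<in> carrier B" for a b
  proof -
    let ?x = "?c (g b) (f a)" and ?y = "?c (f a) (g b)"
    have xy: "?x \<in> carrier ?Z" "?y \<in> carrier ?Z"
      using ab by (simp_all add: M.commutator_in_center)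
    have "?x \<otimes>\<^bsub>?Z\<^esub> ?y = \<one>\<^bsub>?Z\<^esub>"
      using ab by (simp add: M.commutator_inverse[of "f a" "g b"])
    then have "?x [^]\<^bsub>?Z\<^esub> n \<otimes>\<^bsub>?Z\<^esub> ?y [^]\<^bsub>?Z\<^esub> n = \<one>\<^bsub>?Z\<^esub>"
      using xy Zc.nat_pow_distrib[of ?x ?y n] Zc.nat_pow_one[of n] by metis
    then have "\<iota> (?x [^]\<^bsub>?Z\<^esub> n) \<otimes>\<^bsub>E\<^esub> \<iota> (?y [^]\<^bsub>?Z\<^esub> n) = \<one>\<^bsub>E\<^esub>"
      using xy by (metis Zc.nat_pow_closed \<iota>.hom_mult \<iota>.hom_one)
    then have "\<kappa> a b [^]\<^bsub>E\<^esub> n = \<one>\<^bsub>E\<^esub>"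
      unfolding \<kappa>_def using ab xy \<iota>_closed[OF ab]
      by (simp add: E.nat_pow_distrib \<mu>_pow q_eq) (metis \<iota>.hom_nat_pow xy(1))
    then show ?thesis
      using ab \<iota>_closed by (simp add: S_def \<kappa>_def)
  qed
  interpret \<kappa>: pairing A B ?K \<kappa>
  proof unfold_locales
    show "\<kappa> a b \<in> carrier ?K" if "a \<in> carrier A" "b \<in> carrier B" for a b
      using \<kappa>_S that by simp
    show "\<kappa> (a \<otimes>\<^bsub>A\<^esub> a') b = \<kappa> a b \<otimes>\<^bsub>?K\<^esub> \<kappa> a' b"
      if ab: "a \<in> carrier A" "a' \<in> carrier A" "b \<in> carrier B" for a a' b
    proof -
      have "\<iota> (?c (g b) (f (a \<otimes>\<^bsub>A\<^esub> a'))) = \<iota> (?c (g b) (f a)) \<otimes>\<^bsub>E\<^esub> \<iota> (?c (g b) (f a'))"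
        using rb.mult_left[OF ab] \<iota>.hom_mult[of "?c (g b) (f a)" "?c (g b) (f a')"] rb.closed ab by simp
      then show ?thesis
        using ab \<iota>_closed \<mu>.mult_left[OF ab] by (simp add: \<kappa>_def E.m_ac)
    qed
    show "\<kappa> a (b \<otimes>\<^bsub>B\<^esub> b') = \<kappa> a b \<otimes>\<^bsub>?K\<^esub> \<kappa> a b'"
      if ab: "a \<in> carrier A" "b \<in> carrier B" "b' \<in> carrier B" for a b b'
    proof -
      have "\<iota> (?c (g (b \<otimes>\<^bsub>B\<^esub> b')) (f a)) = \<iota> (?c (g b) (f a)) \<otimes>\<^bsub>E\<^esub> \<iota> (?c (g b') (f a))"
        using rb.mult_right[OF ab] \<iota>.hom_mult[of "?c (g b) (f a)" "?c (g b') (f a)"] rb.closed ab by simp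
      then show ?thesis
        using ab \<iota>_closed \<mu>.mult_right[OF ab] by (simp add: \<kappa>_def E.m_ac)
    qed
  qed

  \<comment> \<open>The gluing has third factor \<open>?K\<close>, not all of E, so only those
    central elements of \<open>M\<close> are kept whose images are n-torsion.\<close>
  define Z where "Z = {z \<in> center M. \<iota> z \<in> S}"
  have Z: "subgroup Z M"
  proof (rule M.subgroupI)
    show "Z \<subseteq> carrier M" using M.center_carrier by (auto simp: Z_def)
    show "Z \<noteq> {}"
      using subgroup.one_closed[OF M.subgroup_center] subgroup.one_closed[OF S] \<iota>.hom_one by (auto simp: Z_def)
    show "inv\<^bsub>M\<^esub> z \<in> Z" if "z \<in> Z" for z
      using that subgroup.m_inv_closed[OF M.subgroup_center] subgroup.m_inv_closed[OF S]
        \<iota>.hom_inv[of z] M.m_inv_consistent[OF M.subgroup_center, of z] by (simp add: Z_def)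
    show "z \<otimes>\<^bsub>M\<^esub> z' \<in> Z" if "z \<in> Z" "z' \<in> Z" for z z'
      using that subgroup.m_closed[OF M.subgroup_center] subgroup.m_closed[OF S] \<iota>.hom_mult[of z z']
      by (simp add: Z_def)
  qed
  \<comment> \<open>These preimages are DA' and DB'. On them \<open>\<mu>\<close> vanishes and the
    twist is the original commutator.\<close>
  define NA where "NA = {a \<in> carrier A. \<pi> a \<in> DU}"
  define NB where "NB = {b \<in> carrier B. \<rho> b \<in> DV}"
  interpret gluing A B ?K \<kappa> M f g Z \<iota> NA NB
  proof (intro_locales, rule gluing_axioms.intro)
    show "inj_on f (carrier A)" "inj_on g (carrier B)" using f g by (auto simp: mon_def)
    show "Z \<subseteq> center M" by (auto simp: Z_def)
    show "\<iota> \<in> mon (M\<lparr>carrier := Z\<rparr>) ?K"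
      using \<iota> by (auto simp: mon_def hom_def Z_def inj_on_def)
    show "NA \<lhd> A" "NB \<lhd> B"
      unfolding NA_def NB_def
      using \<pi>.normal_vimage_comm_group[OF U.comm_group_axioms DU] \<rho>.normal_vimage_comm_group[OF V.comm_group_axioms DV]
      by auto
    \<comment> \<open>As \<open>\<mu>\<close> is trivial here, \<open>\<kappa> a b\<close> is the
      image of the commutator, and \<open>\<kappa>_S\<close> shows that the commutator belongs to
      \<open>Z\<close>.\<close>
    show "?c (g b) (f a) \<in> Z \<and> \<kappa> a b = \<iota> (?c (g b) (f a))" if "a \<in> NA" "b \<in> carrier B" for a b
      using that \<kappa>_S[of a b] \<mu>_left[of "\<pi> a" "\<rho> b"] \<iota>_closed[of a b]
      by (simp add: NA_def \<kappa>_def Z_def M.commutator_in_center)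
    show "?c (g b) (f a) \<in> Z \<and> \<kappa> a b = \<iota> (?c (g b) (f a))" if "a \<in> carrier A" "b \<in> NB" for a b
      using that \<kappa>_S[of a b] \<mu>_right[of "\<pi> a" "\<rho> b"] \<iota>_closed[of a b]
      by (simp add: NB_def \<kappa>_def Z_def M.commutator_in_center)
  qed (rule Z)
  have "in_variety m n (twisted_product A B ?K \<kappa>)"
  proof (rule \<kappa>.in_variety_twisted_product[OF mn A B])
    show "e [^]\<^bsub>?K\<^esub> n = \<one>\<^bsub>?K\<^esub>" if "e \<in> carrier ?K" for e
      using that E.nat_pow_consistent[of e n S] by (simp add: S_def)
  qed
  then show ?thesis
  proof (rule weakly_embeddable_gluing)
    show "\<alpha> d \<in> NA" "\<beta> d \<in> NB" if "d \<in> carrier D" for d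
      using that by (auto simp: NA_def NB_def DU_def DV_def)
  qed (rule agree)
qed

theorem theorem4p3:
  fixes m n :: nat
    and A :: "('a, 'x) monoid_scheme" and B :: "('b, 'y) monoid_scheme"
    and D :: "('d, 'z) monoid_scheme"
    and \<alpha> :: "'d \<Rightarrow> 'a" and \<beta> :: "'d \<Rightarrow> 'b"
  assumes "n dvd m div gcd 2 m"
    and "amalgam_in_variety m n A B D \<alpha> \<beta>"
  shows "weakly_embeddable (in_variety m n) A B D \<alpha> \<beta> \<longleftrightarrow>
      weakly_embeddable in_N2 A B D \<alpha> \<beta>
      \<and> (\<forall>d \<in> carrier D. \<alpha> d \<in> power_subgroup A n <#>\<^bsub>A\<^esub> derived A (carrier A)
            \<longrightarrow> \<beta> d \<in> center B)
      \<and> (\<forall>d \<in> carrier D. \<beta> d \<in> power_subgroup B n <#>\<^bsub>B\<^esub> derived B (carrier B)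
            \<longrightarrow> \<alpha> d \<in> center A)"
    (is "?L \<longleftrightarrow> ?N2 \<and> ?CA \<and> ?CB")
proof
  have A: "in_variety m n A" and B: "in_variety m n B" and D: "group D"
    and \<alpha>: "\<alpha> \<in> hom D A" and \<beta>: "\<beta> \<in> hom D B"
    using assms(2) by (auto simp: amalgam_in_variety_def in_variety_def mon_def)
  have grp: "group A" "group B"
    using A B by (auto simp: in_variety_def)
  {
    assume ?L
    then obtain M :: "('a + 'b) list monoid" and f g where M: "in_variety m n M" and f: "f \<in> mon A M" and g: "g \<in> mon B M"
      and agree: "\<forall>d \<in> carrier D. f (\<alpha> d) = g (\<beta> d)"
      unfolding weakly_embeddable_def by blast
    have hom: "f \<in> hom A M" "g \<in> hom B M" using f g by (auto simp: mon_def)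
    have ?N2
      unfolding weakly_embeddable_def using in_variety_imp_N2[OF M] f g agree by blast
    moreover have ?CA
      using weakly_embeddable_imp_central[OF M grp hom(1) g] agree hom_in_carrier[OF \<beta>] by blast
    moreover have ?CB
      using weakly_embeddable_imp_central[OF M grp(2,1) hom(2) f] agree hom_in_carrier[OF \<alpha>] by metis
    ultimately show "?N2 \<and> ?CA \<and> ?CB" by blast
  next
    assume R: "?N2 \<and> ?CA \<and> ?CB"
    then obtain M :: "('a + 'b) list monoid" and f g where M: "in_N2 M" and f: "f \<in> mon A M" and g: "g \<in> mon B M"
      and agree: "\<forall>d \<in> carrier D. f (\<alpha> d) = g (\<beta> d)"
      unfolding weakly_embeddable_def by blast
    show ?L
    \<comment> \<open>For n = 0 the divisibility gives m = 0, so the variety is the class of all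
      groups of class at most two, and the given embedding already suffices.\<close>
    proof (cases "n = 0")
      case True
      then have "m = 0"
        using assms(1) by (metis dvd_0_left_iff dvd_div_eq_0_iff gcd_dvd2)
      with True R show ?thesis
        by (simp add: in_N2_def[abs_def])
    next
      case False
      show ?thesis
        using weakly_embeddable_in_variety[OF _ assms(1) A B D \<alpha> \<beta> M f g] False agree R by blast
    qed
  }
qed

end
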